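(* Let $k\ge 1$ be a fixed integer. For each $n$, let $d=d(n)$ be an integer with $d\ge \log_2 n$, and consider the Random ID Model for Kademlia with $n$ nodes, ID length $d$, bucket size $k$, and a fixed target $y\in\{0,1\}^d$. Let $T_1$ be the searching time for $y$ started from node $1$. Then, as $n\to\infty$, $$\frac{T_1}{\log_2 n}\to \frac{1}{\mu_k}\ \text{ in probability},\qquad \frac{\mathbf{E}\,T_1}{\log_2 n}\to\frac{1}{\mu_k},$$ where $$\mu_k=\sum_{j=1}^{\infty}\left(1-\left(1-\frac{1}{2^{j-1}}\right)^k\right).$$ In particular $\mu_1=2$.
   Context: Random ID Model: $X_1,\dots,X_n$ are chosen uniformly at random from $\{0,1\}^d$ without replacement; $X_i$ is the ID of node $i\in\{1,\dots,n\}$. For $x,y\in\{0,1\}^d$, $\ell(x,y)$ denotes the length of the longest common prefix of $x$ and $y$, and the XOR distance is $\delta(x,y)=\sum_{j=1}^d (x_j\oplus y_j)2^{d-j}$. For $x\in\{0,1\}^d$ and $0\le j\le d$ let $\mathcal S(x,j)=\{i: 1\le i\le n,\ \ell(x,X_i)=j\}$. Each node $i$ keeps $d$ buckets indexed by $j\in\{0,\dots,d-1\}$; bucket $j$ of node $i$ is filled with $\min\{k,|\mathcal S(X_i,j)|\}$ indices drawn uniformly at random without replacement from $\mathcal S(X_i,j)$ (independently over buckets and nodes, given the IDs). Search for $y$ started at node $i$: if $X_i=y$ the search halts; otherwise let $j=\ell(y,X_i)$ and look at bucket $j$ of $i$; if it is empty the search halts; otherwise move to the node $i^*$ in that bucket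 with smallest XOR distance to $y$ (equivalently, one maximizing $\ell(y,X_{i^*})$ among the bucket's entries), and continue the search from $i^*$. The searching time $T_i$ is the number of steps taken before halting (so $T_i=T_{i^*}+1$ when a step is taken). *)

theory Defs
  imports "HOL-Probability.Probability" "HOL-Library.Sublist"
begin

definition bitstrings :: "nat \<Rightarrow> bool list set" where
  "bitstrings d = {x. length x = d}"

definition lcp :: "bool list \<Rightarrow> bool list \<Rightarrow> nat" where
  "lcp x y = length (longest_common_prefix x y)"

text \<open>Bits are numbered from the most significant one; \<open>x ! (j - 1)\<close> is the \<open>j\<close>-th bit.\<close>

definition xor_dist :: "nat \<Rightarrow> bool list \<Rightarrow> bool list \<Rightarrow> nat" where
  "xor_dist d x y = (\<Sum>j=1..d. of_bool (x ! (j - 1) \<noteq> y ! (j - 1)) * 2 ^ (d - j))"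

text \<open>A uniform sample without replacement, as an injective function on the nodes \<open>{1..n}\<close>.\<close>

definition id_assignments :: "nat \<Rightarrow> nat \<Rightarrow> (nat \<Rightarrow> bool list) set" where
  "id_assignments n d = {X \<in> {1..n} \<rightarrow>\<^sub>E bitstrings d. inj_on X {1..n}}"

definition nodes_at :: "nat \<Rightarrow> (nat \<Rightarrow> bool list) \<Rightarrow> bool list \<Rightarrow> nat \<Rightarrow> nat set" where
  "nodes_at n X x j = {i \<in> {1..n}. lcp x (X i) = j}"

definition bucket_pmf :: "nat \<Rightarrow> nat set \<Rightarrow> nat set pmf" where
  "bucket_pmf k S = pmf_of_set {A. A \<subseteq> S \<and> card A = min k (card S)}"

text \<open>An outcome is a pair \<open>(X, B)\<close>, where \<open>X i\<close> is the ID of node \<open>i\<close> and \<open>B (i, j)\<close> is its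
  bucket \<open>j\<close>. Given \<open>X\<close>, the buckets are independent.\<close>

definition kademlia ::
  "nat \<Rightarrow> nat \<Rightarrow> nat \<Rightarrow> ((nat \<Rightarrow> bool list) \<times> (nat \<times> nat \<Rightarrow> nat set)) pmf" where
  "kademlia k n d =
     bind_pmf (pmf_of_set (id_assignments n d)) (\<lambda>X.
       map_pmf (Pair X)
         (Pi_pmf ({1..n} \<times> {..<d}) {} (\<lambda>(i, j). bucket_pmf k (nodes_at n X (X i) j))))"

text \<open>\<open>search d y X B i t\<close>: the search for \<open>y\<close> started at node \<open>i\<close> halts after exactly \<open>t\<close> steps.\<close>

inductive search ::
  "nat \<Rightarrow> bool list \<Rightarrow> (nat \<Rightarrow> bool list) \<Rightarrow> (nat \<times> nat \<Rightarrow> nat set) \<Rightarrow> nat \<Rightarrow> nat \<Rightarrow> bool"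
  for d y X B where
  found: "X i = y \<Longrightarrow> search d y X B i 0"
| stuck: "X i \<noteq> y \<Longrightarrow> B (i, lcp y (X i)) = {} \<Longrightarrow> search d y X B i 0"
| step: "X i \<noteq> y \<Longrightarrow> B (i, lcp y (X i)) \<noteq> {} \<Longrightarrow>
    search d y X B (arg_min_on (\<lambda>m. xor_dist d (X m) y) (B (i, lcp y (X i)))) t \<Longrightarrow>
    search d y X B i (Suc t)"

text \<open>The description is proper for all outcomes of positive probability; see
  \<open>search_ex1\<close> below.\<close>

definition search_time ::
  "nat \<Rightarrow> bool list \<Rightarrow> nat \<Rightarrow> (nat \<Rightarrow> bool list) \<times> (nat \<times> nat \<Rightarrow> nat set) \<Rightarrow> nat" where
  "search_time d y i = (\<lambda>(X, B). THE t. search d y X B i t)"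

text \<open>The index is shifted by one: the summand for \<open>j\<close> uses \<open>2 ^ j\<close>, where \<open>j\<close> starts at \<open>0\<close>.\<close>

definition mu :: "nat \<Rightarrow> real" where
  "mu k = (\<Sum>j. 1 - (1 - 1 / 2 ^ j) ^ k)"

lemma summable_mu: "summable (\<lambda>j. 1 - (1 - 1 / 2 ^ j) ^ k :: real)"
proof (rule summable_comparison_test)
  have "summable (\<lambda>j. (1 / 2) ^ j :: real)" by (rule summable_geometric) simp
  then show "summable (\<lambda>j. real k * (1 / 2) ^ j)" by (rule summable_mult)
  have "norm (1 - (1 - 1 / 2 ^ j) ^ k :: real) \<le> real k * (1 / 2) ^ j" for j
  proof -
    have "1 + real k * (- (1 / 2 ^ j)) \<le> (1 + - (1 / 2 ^ j)) ^ k"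
      by (rule Bernoulli_inequality) simp
    moreover have "(1 - 1 / 2 ^ j :: real) ^ k \<le> 1"
      by (rule power_le_one) auto
    ultimately show ?thesis by (simp add: power_one_over)
  qed
  then show "\<exists>N. \<forall>j\<ge>N. norm (1 - (1 - 1 / 2 ^ j) ^ k :: real) \<le> real k * (1 / 2) ^ j" by blast
qed

lemma finite_bitstrings: "finite (bitstrings d)"
  and card_bitstrings: "card (bitstrings d) = 2 ^ d"
proof -
  have eq: "bitstrings d = {x. set x \<subseteq> (UNIV :: bool set) \<and> length x = d}"
    by (simp add: bitstrings_def)
  show "finite (bitstrings d)" unfolding eq by (rule finite_lists_length_eq) (rule finite)
  show "card (bitstrings d) = 2 ^ d"
    unfolding eq card_lists_length_eq[OF finite[of "UNIV :: bool set"]] card_UNIV_bool by (rule refl)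
qed

lemma id_assignments_nonempty:
  assumes "n \<ge> 1" "real d \<ge> log 2 (real n)"
  shows "id_assignments n d \<noteq> {}"
proof -
  have "real n = 2 powr log 2 (real n)"
    using assms(1) by simp
  also have "\<dots> \<le> 2 powr real d"
    using assms(2) by (rule powr_mono) simp
  also have "\<dots> = real (2 ^ d)"
    by (simp add: powr_realpow)
  finally have "n \<le> 2 ^ d"
    unfolding of_nat_le_iff .
  then have "card {1..n} \<le> card (bitstrings d)"
    unfolding card_bitstrings by simp
  then have "\<exists>f. f ` {1..n} \<subseteq> bitstrings d \<and> inj_on f {1..n}"
    by (intro card_le_inj finite_atLeastAtMost finite_bitstrings)
  then obtain f where f: "f ` {1..n} \<subseteq> bitstrings d" and inj: "inj_on f {1..n}"
    by (elim exE conjE) (rule that)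
  have "inj_on (restrict f {1..n}) {1..n}"
    using inj by (simp only: inj_on_restrict_eq)
  moreover have "restrict f {1..n} \<in> {1..n} \<rightarrow>\<^sub>E bitstrings d"
    using f by (intro restrict_PiE_iff[THEN iffD2]) blast
  ultimately have "restrict f {1..n} \<in> id_assignments n d"
    by (simp only: id_assignments_def mem_Collect_eq simp_thms)
  then show ?thesis by (rule ex_in_conv[THEN iffD1, OF exI])
qed

lemma finite_id_assignments: "finite (id_assignments n d)"
proof -
  have "finite ({1..n} \<rightarrow>\<^sub>E bitstrings d)"
    by (intro finite_PiE finite_bitstrings finite_atLeastAtMost)
  then show ?thesis by (simp add: id_assignments_def)
qed

lemma set_bucket_pmf:
  assumes "finite S"
  shows "set_pmf (bucket_pmf k S) = {A. A \<subseteq> S \<and> card A = min k (card S)}"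
  unfolding bucket_pmf_def
proof (rule set_pmf_of_set)
  obtain A where "A \<subseteq> S" "card A = min k (card S)"
    using obtain_subset_with_card_n[of "min k (card S)" S] by auto
  then show "{A. A \<subseteq> S \<and> card A = min k (card S)} \<noteq> {}" by blast
  show "finite {A. A \<subseteq> S \<and> card A = min k (card S)}" using assms by simp
qed

lemma set_kademlia:
  assumes "n \<ge> 1" "real d \<ge> log 2 (real n)" "(X, B) \<in> set_pmf (kademlia k n d)"
  shows "X \<in> id_assignments n d"
    and "\<And>i j. i \<in> {1..n} \<Longrightarrow> j < d \<Longrightarrow> B (i, j) \<subseteq> nodes_at n X (X i) j"
proof -
  let ?p = "\<lambda>(i, j). bucket_pmf k (nodes_at n X (X i) j)"
  have "set_pmf (pmf_of_set (id_assignments n d)) = id_assignments n d"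
    by (intro set_pmf_of_set id_assignments_nonempty finite_id_assignments assms)
  then have X: "X \<in> id_assignments n d"
    and B: "B \<in> set_pmf (Pi_pmf ({1..n} \<times> {..<d}) {} ?p)"
    using assms(3) unfolding kademlia_def by auto
  show "X \<in> id_assignments n d" by (rule X)
  have B': "B \<in> PiE_dflt ({1..n} \<times> {..<d}) {} (set_pmf \<circ> ?p)"
    using B by (subst (asm) set_Pi_pmf) simp_all
  fix i j assume "i \<in> {1..n}" "j < d"
  then have "B (i, j) \<in> set_pmf (bucket_pmf k (nodes_at n X (X i) j))"
    using B' by (force simp: PiE_dflt_def)
  moreover have "finite (nodes_at n X (X i) j)" by (simp add: nodes_at_def)
  ultimately show "B (i, j) \<subseteq> nodes_at n X (X i) j"
    by (simp add: set_bucket_pmf)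
qed

lemma lcp_less:
  assumes "x \<noteq> y" "length x = length y"
  shows "lcp y x < length y"
  using assms unfolding lcp_def
  by (induction y x rule: longest_common_prefix.induct) auto

text \<open>Each step enters a strictly longer common prefix with the target.\<close>

lemma lcp_step:
  assumes "length x = length y" "length z = length y" "x \<noteq> y" "lcp x z = lcp y x"
  shows "lcp y x < lcp y z"
  using assms unfolding lcp_def
proof (induction y x arbitrary: z rule: longest_common_prefix.induct)
  case (1 a ys b xs)
  then show ?case by (cases z) (auto split: if_splits)
qed auto

lemma search_unique: "search d y X B i t \<Longrightarrow> search d y X B i t' \<Longrightarrow> t = t'"
proof (induction arbitrary: t' rule: search.induct)
  case (found i)
  from found.prems found.hyps show ?case by (cases rule: search.cases) simp_all
next
  case (stuck i)
  from stuck.prems stuck.hyps show ?case by (cases rule: search.cases) simp_all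
next
  case (step i t)
  from step.prems step.hyps(1,2) step.IH show ?case by (cases rule: search.cases) simp_all
qed

theorem search_ex1:
  assumes "n \<ge> 1" "real d \<ge> log 2 (real n)" "length y = d"
    and "(X, B) \<in> set_pmf (kademlia k n d)" "i \<in> {1..n}"
  shows "\<exists>!t. search d y X B i t"
proof -
  note supp = set_kademlia[OF assms(1,2,4)]
  have len: "length (X m) = d" if "m \<in> {1..n}" for m
    using supp(1) that by (auto simp: id_assignments_def bitstrings_def)
  have "\<exists>t. search d y X B i t"
    using assms(5)
  proof (induction "d - lcp y (X i)" arbitrary: i rule: less_induct)
    case less
    let ?C = "B (i, lcp y (X i))" and ?f = "\<lambda>m. xor_dist d (X m) y"
    show ?case
    proof (cases "X i = y \<or> ?C = {}")
      case True
      then show ?thesis by (metis search.found search.stuck)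
    next
      case False
      have lt: "lcp y (X i) < d"
        using lcp_less[of "X i" y] False len[OF less.prems] assms(3) by simp
      have sub: "?C \<subseteq> nodes_at n X (X i) (lcp y (X i))"
        using supp(2) less.prems lt by blast
      moreover have "finite ?C"
        using sub by (rule finite_subset) (simp add: nodes_at_def)
      ultimately have "arg_min_on ?f ?C \<in> nodes_at n X (X i) (lcp y (X i))"
        using False arg_min_if_finite(1)[of ?C ?f] by blast
      then have m: "arg_min_on ?f ?C \<in> {1..n}"
        and eq: "lcp (X i) (X (arg_min_on ?f ?C)) = lcp y (X i)"
        by (auto simp: nodes_at_def)
      have "lcp y (X i) < lcp y (X (arg_min_on ?f ?C))"
        using lcp_step[OF _ _ _ eq] len[OF less.prems] len[OF m] assms(3) False by simp
      then have "d - lcp y (X (arg_min_on ?f ?C)) < d - lcp y (X i)"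
        using lt by simp
      from less.hyps[OF this m] show ?thesis using False by (metis search.step)
    qed
  qed
  then show ?thesis using search_unique by metis
qed

end

(*
  Condition on the IDs. From a node whose ID shares exactly j bits with y, bucket j is a uniform
  sample of size min k N from the N nodes sharing more than j bits with y, and buckets met along
  the way are distinct, so the search is a Markov chain on common prefix lengths. The number of
  nodes sharing at least j bits is close to n / 2^j by Chebyshev's inequality, simultaneously for
  all j <= log2 n - r, and hence a step has mean close to mu k and bounded second moment. With
  J = log2 n - r, the process (mu k) * steps - (J - min j J) is then nearly a martingale; its
    second
  moment is at most a small multiple of (log2 n)^2. From level log2 n - 2r on, at most about 3r
  steps remain. For the mean, the search time never exceeds the largest common prefix length, whose
  excess over log2 n has bounded expectation.
*)

theory Submission
  imports Defs "HOL-Combinatorics.Transposition" "HOL-Real_Asymp.Real_Asymp"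
begin

text \<open>The constant \<open>mu k\<close> is the mean advance of one step: of the nodes deeper
  than level j, about a fraction 2^-i lies deeper than j + i, and the best of k entries gets beyond
  j + i unless all k miss that fraction. The obstacle is that the sizes of levels within a bounded
  distance of log2 n are not concentrated. Advances are therefore truncated at \<open>L - r\<close>,
  where L is the integer part of log2 n, while the recursion already stops at
  \<open>L - 2 * r\<close>; the gap of r levels keeps the part of \<open>mu k\<close> lost by
  truncation of order 2^-r. The margin r stays fixed while n grows. The drift error per step then
  does not tend to 0; it contributes its own multiple of L^2 to the second moment, which is divided
  by (epsilon L)^2. So r is chosen first, to make this multiple small, and L afterwards. The failure
  probability of the ID estimates also depends on r only, since the Chebyshev bounds grow
  geometrically with depth and the deepest level dominates. The final bounds involve n only through
  L and log2 n, and neither d nor y, which may vary freely with n.\<close>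

section \<open>Common prefixes and the XOR distance\<close>

lemma le_lcp_iff: "j \<le> lcp x y \<longleftrightarrow> j \<le> length x \<and> j \<le> length y \<and> take j x = take j y"
  unfolding lcp_def
proof (induction x y arbitrary: j rule: longest_common_prefix.induct)
  case (1 a xs b ys)
  then show ?case by (cases j) auto
qed (auto)

text \<open>Where x leaves y, the string z still carries the bit of y, so x and z part at the same
  place. This is the converse of \<open>lcp_step\<close>, which relies on there being only two
  possible bits.\<close>

lemma lcp_eq_if_lt:
  assumes "length x = length y" "length z = length y" "lcp y x < lcp y z"
  shows "lcp x z = lcp y x"
  using assms unfolding lcp_def
proof (induction y x arbitrary: z rule: longest_common_prefix.induct)
  case (1 a ys b xs)
  then show ?case by (cases z) (auto split: if_splits)
qed auto

lemma lcp_le: "lcp y x \<le> length y"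
  by (meson le_lcp_iff order_refl)

lemma xor_dist_Cons:
  "xor_dist (Suc d) (a # x) (b # y) = of_bool (a \<noteq> b) * 2 ^ d + xor_dist d x y"
  unfolding xor_dist_def One_nat_def
  by (subst sum.atLeast_Suc_atMost, simp, subst sum.shift_bounds_cl_Suc_ivl)
     (auto intro!: sum.cong simp: nth_Cons')

lemma xor_dist_less: "length x = d \<Longrightarrow> length y = d \<Longrightarrow> xor_dist d x y < 2 ^ d"
proof (induction d arbitrary: x y)
  case 0 then show ?case by (simp add: xor_dist_def)
next
  case (Suc d)
  then obtain a x' b y' where "x = a # x'" "y = b # y'" by (metis length_Suc_conv)
  with Suc.prems Suc.IH[of x' y'] show ?case by (auto simp: xor_dist_Cons)
qed

text \<open>At the first bit where x leaves y, z still agrees with y; that bit outweighs all later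
  bits together, by \<open>xor_dist_less\<close>. Hence a minimizer of the XOR distance maximizes
  the common prefix.\<close>

lemma xor_dist_less_if_lcp_less:
  assumes "length x = d" "length z = d" "length y = d" "lcp y x < lcp y z"
  shows "xor_dist d z y < xor_dist d x y"
  using assms
proof (induction d arbitrary: x y z)
  case 0 then show ?case by (simp add: lcp_def)
next
  case (Suc d)
  then obtain a x' b y' c z' where eq: "x = a # x'" "y = b # y'" "z = c # z'"
    by (metis length_Suc_conv)
  have "c = b" using Suc.prems by (auto simp: eq lcp_def split: if_splits)
  show ?case
  proof (cases "a = b")
    case True
    then show ?thesis using Suc \<open>c = b\<close> by (auto simp: eq lcp_def xor_dist_Cons)
  next
    case False
    then show ?thesis using Suc.prems \<open>c = b\<close> xor_dist_less[of z' d y']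
      by (auto simp: eq xor_dist_Cons)
  qed
qed

lemma card_subtree:
  assumes "length y = d" "j \<le> d"
  shows "card {x \<in> bitstrings d. j \<le> lcp y x} = 2 ^ (d - j)"
proof -
  have "{x \<in> bitstrings d. j \<le> lcp y x} = (\<lambda>z. take j y @ z) ` bitstrings (d - j)"
  proof (intro equalityI subsetI)
    fix x assume "x \<in> {x \<in> bitstrings d. j \<le> lcp y x}"
    then have "take j y = take j x" "length x = d"
      using assms by (auto simp: bitstrings_def le_lcp_iff)
    then show "x \<in> (\<lambda>z. take j y @ z) ` bitstrings (d - j)"
      by (intro image_eqI[of _ _ "drop j x"]) (auto simp: bitstrings_def)
  qed (use assms in \<open>auto simp: bitstrings_def le_lcp_iff\<close>)
  then show ?thesis
    using card_bitstrings[of "d - j"] by (simp add: card_image inj_on_def)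
qed

section \<open>Second moments of hitting times\<close>

text \<open>All distributions below have finite support, so the tower rule is available for signed
  functions without any integrability condition.\<close>

lemma expectation_bind_finite:
  fixes h :: "'b \<Rightarrow> real"
  assumes "finite (set_pmf p)" "\<And>x. x \<in> set_pmf p \<Longrightarrow> finite (set_pmf (f x))"
  shows "measure_pmf.expectation (bind_pmf p f) h
       = measure_pmf.expectation p (\<lambda>x. measure_pmf.expectation (f x) h)"
  using assms by (simp add: pmf_expectation_bind[OF assms(1)] integral_measure_pmf[OF assms(1)])

lemma expectation_mono_finite:
  fixes f g :: "'a \<Rightarrow> real"
  assumes "finite (set_pmf p)" "\<And>x. x \<in> set_pmf p \<Longrightarrow> f x \<le> g x"
  shows "measure_pmf.expectation p f \<le> measure_pmf.expectation p g"
  by (rule integral_mono_AE) (auto intro!: integrable_measure_pmf_finite assms simp: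
    AE_measure_pmf_iff)

lemma abs_expectation_le:
  fixes f :: "'a \<Rightarrow> real"
  assumes "finite (set_pmf p)" "\<And>x. x \<in> set_pmf p \<Longrightarrow> \<bar>f x\<bar> \<le> c"
  shows "\<bar>measure_pmf.expectation p f\<bar> \<le> c"
proof -
  have "\<bar>measure_pmf.expectation p f\<bar> \<le> measure_pmf.expectation p (\<lambda>x. \<bar>f x\<bar>)"
    by (rule integral_abs_bound)
  also have "\<dots> \<le> measure_pmf.expectation p (\<lambda>_. c)"
    by (rule expectation_mono_finite) (use assms in auto)
  finally show ?thesis by simp
qed

text \<open>The cross term in the recursion for the second moment is harmless because the mean deviation
  still to come is itself at most \<open>\<kappa> * J' + H\<close>.\<close>

lemma chain_moments:
  fixes R :: "'v \<Rightarrow> nat pmf" and K :: "'v \<Rightarrow> 'v pmf" and l :: "'v \<Rightarrow> nat"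
    and \<mu> \<kappa> C H :: real and J J' :: nat
  defines "Y \<equiv> \<lambda>v t. \<mu> * real t - (real J - real (min (l v) J))"
  defines "b \<equiv> \<lambda>v w. \<mu> - (real (min (l w) J) - real (l v))"
  assumes finR: "\<And>v. v \<in> V \<Longrightarrow> finite (set_pmf (R v))"
    and finK: "\<And>v. v \<in> V \<Longrightarrow> l v < J' \<Longrightarrow> finite (set_pmf (K v))"
    and K: "\<And>v w. v \<in> V \<Longrightarrow> l v < J' \<Longrightarrow> w \<in> set_pmf (K v) \<Longrightarrow> w \<in> V \<and> l v < l w"
    and R: "\<And>v. v \<in> V \<Longrightarrow> l v < J' \<Longrightarrow> R v = bind_pmf (K v) (\<lambda>w. map_pmf Suc (R w))"
    and drift: "\<And>v. v \<in> V \<Longrightarrow> l v < J' \<Longrightarrow> \<bar>measure_pmf.expectation (K v) (b v)\<bar> \<le> \<kappa>"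
    and var: "\<And>v. v \<in> V \<Longrightarrow> l v < J' \<Longrightarrow> measure_pmf.expectation (K v) (\<lambda>w. (b v w)\<^sup>2) \<le> C"
    and fin: "\<And>v t. v \<in> V \<Longrightarrow> J' \<le> l v \<Longrightarrow> t \<in> set_pmf (R v) \<Longrightarrow> \<bar>Y v t\<bar> \<le> H"
    and "J' \<le> J" "1 \<le> C" "0 \<le> \<kappa>" "0 \<le> H" "v \<in> V"
  shows "\<bar>measure_pmf.expectation (R v) (Y v)\<bar> \<le> \<kappa> * (J' - l v) + H"
    and "measure_pmf.expectation (R v) (\<lambda>t. (Y v t)\<^sup>2)
         \<le> H\<^sup>2 + (J' - l v) * (C + 2 * C * (\<kappa> * J' + H))"
proof -
  let ?E = measure_pmf.expectation
  let ?D = "C + 2 * C * (\<kappa> * J' + H)"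
  have D0: "0 \<le> ?D" using assms by simp
  have "\<bar>?E (R v) (Y v)\<bar> \<le> \<kappa> * (J' - l v) + H \<and>
    ?E (R v) (\<lambda>t. (Y v t)\<^sup>2) \<le> H\<^sup>2 + (J' - l v) * ?D"
    using \<open>v \<in> V\<close>
  proof (induction "J' - l v" arbitrary: v rule: less_induct)
    case less
    show ?case
    proof (cases "l v < J'")
      case False
      then have Y: "\<bar>Y v t\<bar> \<le> H" if "t \<in> set_pmf (R v)" for t using fin less.prems that by simp
      then have Y2: "\<bar>(Y v t)\<^sup>2\<bar> \<le> H\<^sup>2" if "t \<in> set_pmf (R v)" for t
        using that by (metis abs_ge_zero abs_power2 power2_abs power_mono)
      from abs_expectation_le[OF finR Y] abs_expectation_le[OF finR Y2] less.prems False
      show ?thesis by simp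
    next
      case True
      note fK = finK[OF less.prems True]
      have IH: "\<bar>?E (R w) (Y w)\<bar> \<le> \<kappa> * (J' - l w) + H"
        "?E (R w) (\<lambda>t. (Y w t)\<^sup>2) \<le> H\<^sup>2 + (J' - l w) * ?D" if "w \<in> set_pmf (K v)" for w
        using less.hyps[of w] K[OF less.prems True that] True by auto
      have fR: "finite (set_pmf (R w))" if "w \<in> set_pmf (K v)" for w
        using finR K[OF less.prems True that] by simp
      have expR: "?E (R v) h = ?E (K v) (\<lambda>w. ?E (R w) (\<lambda>t. h (Suc t)))" for h :: "nat \<Rightarrow> real"
        unfolding R[OF less.prems True]
        by (subst expectation_bind_finite) (use fK fR in simp_all)
      \<comment> \<open>Since \<open>l v < J'\<close> and \<open>J' \<le> J\<close>, the truncation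
        is inactive at v itself, and the deviation is additive along the chain.\<close>
      have Y: "Y v (Suc t) = Y w t + b v w" for w t
        using True \<open>J' \<le> J\<close> by (simp add: Y_def b_def algebra_simps)
      have int: "integrable (measure_pmf (R w)) (h :: nat \<Rightarrow> real)" if "w \<in> set_pmf (K v)" for w h
        using fR[OF that] by (rule integrable_measure_pmf_finite)
      have intK: "integrable (measure_pmf (K v)) (h :: 'v \<Rightarrow> real)" for h
        using fK by (rule integrable_measure_pmf_finite)
      \<comment> \<open>A step gains at least one level, so the bounds for w leave one unit,
        \<kappa> for the mean and \<open>?D\<close> for the second moment, to pay for the
        step.\<close>
      have s: "real (J' - l w) \<le> real (J' - l v) - 1" if "w \<in> set_pmf (K v)" for w
        using K[OF less.prems True that] True by linarith

      have "?E (R v) (Y v) = ?E (K v) (\<lambda>w. ?E (R w) (Y w) + b v w)"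
        unfolding expR
      proof (rule integral_cong_AE)
        show "AE w in measure_pmf (K v). ?E (R w) (\<lambda>t. Y v (Suc t)) = ?E (R w) (Y w) + b v w"
          unfolding AE_measure_pmf_iff
        proof
          fix w assume "w \<in> set_pmf (K v)"
          then show "?E (R w) (\<lambda>t. Y v (Suc t)) = ?E (R w) (Y w) + b v w"
            using int unfolding Y[of _ w] by simp
        qed
      qed simp_all
      also have "\<dots> = ?E (K v) (\<lambda>w. ?E (R w) (Y w)) + ?E (K v) (b v)"
        using intK by simp
      finally have "\<bar>?E (R v) (Y v)\<bar> \<le> \<bar>?E (K v) (\<lambda>w. ?E (R w) (Y w))\<bar> + \<bar>?E (K v) (b v)\<bar>"
        by simp
      also have "\<bar>?E (K v) (\<lambda>w. ?E (R w) (Y w))\<bar> \<le> \<kappa> * (real (J' - l v) - 1) + H"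
      proof (rule abs_expectation_le[OF fK])
        fix w assume w: "w \<in> set_pmf (K v)"
        show "\<bar>?E (R w) (Y w)\<bar> \<le> \<kappa> * (real (J' - l v) - 1) + H"
          using IH(1)[OF w] mult_left_mono[OF s[OF w] \<open>0 \<le> \<kappa>\<close>] by linarith
      qed
      also note drift[OF less.prems True]
      finally have 1: "\<bar>?E (R v) (Y v)\<bar> \<le> \<kappa> * (J' - l v) + H" by (simp add: algebra_simps)

      let ?B = "\<kappa> * J' + H"
      have B0: "0 \<le> ?B" using assms by simp
      have bd: "?E (R w) (\<lambda>t. (Y v (Suc t))\<^sup>2)
        \<le> (H\<^sup>2 + (real (J' - l v) - 1) * ?D) + ?B * (1 + (b v w)\<^sup>2) + (b v w)\<^sup>2"
        if w: "w \<in> set_pmf (K v)" for w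
      proof -
        have "?E (R w) (\<lambda>t. (Y v (Suc t))\<^sup>2) = ?E (R w) (\<lambda>t. (Y w t)\<^sup>2 + 2 * b v w * Y w t
          + (b v w)\<^sup>2)"
          unfolding Y[of _ w] by (simp add: power2_sum algebra_simps)
        also have "\<dots> = ?E (R w) (\<lambda>t. (Y w t)\<^sup>2) + 2 * b v w * ?E (R w) (Y w) + (b v w)\<^sup>2"
          using int[OF w] by simp
        also have "?E (R w) (\<lambda>t. (Y w t)\<^sup>2) \<le> H\<^sup>2 + (real (J' - l v) - 1) * ?D"
          using IH(2)[OF w] mult_right_mono[OF s[OF w] D0] by linarith
        also have "2 * b v w * ?E (R w) (Y w) \<le> \<bar>2 * b v w * ?E (R w) (Y w)\<bar>" by simp
        also have "\<dots> = 2 * \<bar>b v w\<bar> * \<bar>?E (R w) (Y w)\<bar>" by (simp add: abs_mult)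
        \<comment> \<open>Trading |b| for its square makes the second-moment hypothesis on b
          sufficient; after averaging, \<open>1 \<le> C\<close> turns the factor into 2 * C.\<close>
        also have "\<dots> \<le> (1 + (b v w)\<^sup>2) * ?B"
        proof (rule mult_mono)
          have "0 \<le> (1 - \<bar>b v w\<bar>)\<^sup>2" by simp
          then show "2 * \<bar>b v w\<bar> \<le> 1 + (b v w)\<^sup>2" by (simp add: power2_diff)
          have "\<kappa> * real (J' - l w) \<le> \<kappa> * J'" using \<open>0 \<le> \<kappa>\<close> by (intro mult_left_mono) auto
          then show "\<bar>?E (R w) (Y w)\<bar> \<le> ?B" using IH(1)[OF w] by linarith
        qed (use B0 in auto)
        finally show ?thesis by (simp add: algebra_simps)
      qed
      have "?E (R v) (\<lambda>t. (Y v t)\<^sup>2)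
          \<le> ?E (K v) (\<lambda>w. (H\<^sup>2 + (real (J' - l v) - 1) * ?D) + ?B * (1 + (b v w)\<^sup>2) + (b v w)\<^sup>2)"
        unfolding expR by (rule expectation_mono_finite[OF fK bd])
      also have "\<dots> = (H\<^sup>2 + (real (J' - l v) - 1) * ?D) + ?B * (1 + ?E (K v) (\<lambda>w. (b v w)\<^sup>2))
           + ?E (K v) (\<lambda>w. (b v w)\<^sup>2)"
        using intK by simp
      also have "?B * (1 + ?E (K v) (\<lambda>w. (b v w)\<^sup>2)) \<le> ?B * (C + C)"
        using var[OF less.prems True] B0 \<open>1 \<le> C\<close> by (intro mult_left_mono) auto
      also note var[OF less.prems True]
      finally have "?E (R v) (\<lambda>t. (Y v t)\<^sup>2) \<le> H\<^sup>2 + (J' - l v) * ?D"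
        by (simp add: algebra_simps)
      with 1 show ?thesis by simp
    qed
  qed
  then show "\<bar>?E (R v) (Y v)\<bar> \<le> \<kappa> * (J' - l v) + H"
    "?E (R v) (\<lambda>t. (Y v t)\<^sup>2) \<le> H\<^sup>2 + (J' - l v) * ?D" by auto
qed

section \<open>One step of the search\<close>

text \<open>The k-subsets of A missing B are the k-subsets of A - B, and the quotient of the two
  binomial coefficients is one of falling factorials. If A - B has fewer than k elements, some
  factor is zero.\<close>

lemma prob_bucket_disjoint:
  assumes "finite A" "B \<subseteq> A" "k \<le> card A"
  shows "measure_pmf.prob (bucket_pmf k A) {S. S \<inter> B = {}}
       = (\<Prod>i<k. (real (card A) - real (card B) - real i) / (real (card A) - real i))"
proof -
  let ?\<Omega> = "{S. S \<subseteq> A \<and> card S = k}"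
  have card: "card ?\<Omega> = card A choose k" using assms n_subsets by blast
  have fin: "finite ?\<Omega>" using assms by simp
  have ne: "?\<Omega> \<noteq> {}" using card assms(3)
    by (metis card.empty zero_less_binomial_iff less_numeral_extra(3))
  have "card (A - B) = card A - card B" using assms by (simp add: card_Diff_subset finite_subset)
  moreover have "?\<Omega> \<inter> {S. S \<inter> B = {}} = {S. S \<subseteq> A - B \<and> card S = k}" using assms by auto
  ultimately have "card (?\<Omega> \<inter> {S. S \<inter> B = {}}) = (card A - card B) choose k"
    using n_subsets[of "A - B" k] assms by simp
  then have "measure_pmf.prob (bucket_pmf k A) {S. S \<inter> B = {}}
      = real ((card A - card B) choose k) / real (card A choose k)"
    unfolding bucket_pmf_def using assms(3) fin ne card
      by (simp add: measure_pmf_of_set min_absorb1)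
  also have "\<dots> = (\<Prod>i<k. (real (card A) - real (card B) - real i) / (real (card A) - real i))"
    using card_mono[OF assms(1,2)]
    by (simp add: binomial_gbinomial gbinomial_prod_rev prod_dividef atLeast0LessThan of_nat_diff)
  finally show ?thesis .
qed

text \<open>Compares sampling without replacement with k independent draws: the two products have
  factors of modulus at most 1, so they differ by at most the sum of the factorwise differences,
  each at most 2 * k / card A.\<close>

lemma prob_bucket_hit:
  assumes "finite A" "B \<subseteq> A" "2 * k \<le> card A"
  defines "w \<equiv> real (card B) / real (card A)"
  shows "\<bar>measure_pmf.prob (bucket_pmf k A) {S. S \<inter> B \<noteq> {}} - (1 - (1 - w) ^ k)\<bar>
    \<le> 2 * (real k)\<^sup>2 / real (card A)"
proof (cases "k = 0")
  case True
  then show ?thesis using prob_bucket_disjoint[OF assms(1,2), of 0]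
    measure_pmf.prob_compl[of "{S. S \<inter> B = {}}" "bucket_pmf 0 A"]
    by (simp add: Compl_eq_Diff_UNIV[symmetric] Collect_neg_eq[symmetric])
next
  case False
  define N where "N = real (card A)"
  define c where "c = real (card B)"
  have N: "2 * real k \<le> N" "0 < N" using assms(3) False by (auto simp: N_def)
  have c: "0 \<le> c" "c \<le> N" using card_mono[OF assms(1,2)] by (auto simp: c_def N_def)
  let ?g = "\<lambda>i. (N - c - real i) / (N - real i)"
  have g: "?g i = 1 - c / (N - i)" if "i < k" for i
    using that N by (simp add: field_simps)
  have "\<bar>(\<Prod>i<k. ?g i) - (\<Prod>i<k. 1 - c / N)\<bar> \<le> (\<Sum>i<k. \<bar>?g i - (1 - c / N)\<bar>)"
  proof (rule norm_prod_diff[where 'a = real, unfolded real_norm_def])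
    fix i assume "i \<in> {..<k}"
    then have i: "i < k" by simp
    \<comment> \<open>A factor is negative when fewer than i elements lie outside B, but at least
      half of A is left after i draws, so c / (N - i) is at most 2 and the modulus stays at most
      1.\<close>
    have "2 * real i \<le> 2 * real k" using i by simp
    then have "2 * real i \<le> N" using N(1) by (rule order_trans)
    then have "c \<le> 2 * (N - i)" using c(2) by (simp add: right_diff_distrib)
    then have "0 \<le> c / (N - i)" "c / (N - i) \<le> 2" using i N c by (auto simp: field_simps)
    then show "\<bar>?g i\<bar> \<le> 1" unfolding g[OF i] by simp
    have "0 \<le> c / N" "c / N \<le> 1" using N c by auto
    then show "\<bar>1 - c / N\<bar> \<le> 1" by linarith
  qed
  also have "\<dots> \<le> (\<Sum>i<k. 2 * k / N)"
  proof (rule sum_mono)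
    fix i assume "i \<in> {..<k}"
    then have i: "i < k" by simp
    have "\<bar>?g i - (1 - c / N)\<bar> = (c / N) * (i / (N - i))"
      unfolding g[OF i] using i N c by (simp add: field_simps)
    also have "\<dots> \<le> 1 * (k / (N / 2))"
      using i N c by (intro mult_mono frac_le) auto
    finally show "\<bar>?g i - (1 - c / N)\<bar> \<le> 2 * k / N" by (simp add: mult.commute)
  qed
  also have "\<dots> = 2 * (real k)\<^sup>2 / N" by (simp add: power2_eq_square)
  finally have "\<bar>(\<Prod>i<k. ?g i) - (1 - w) ^ k\<bar> \<le> 2 * (real k)\<^sup>2 / N"
    by (simp add: w_def c_def N_def)
  moreover have "measure_pmf.prob (bucket_pmf k A) {S. S \<inter> B \<noteq> {}} = 1 - (\<Prod>i<k. ?g i)"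
    using prob_bucket_disjoint[OF assms(1,2), of k] assms(3)
    measure_pmf.prob_compl[of "{S. S \<inter> B = {}}" "bucket_pmf k A"]
    by (simp add: Compl_eq_Diff_UNIV[symmetric] Collect_neg_eq[symmetric] c_def N_def)
  ultimately show ?thesis by (simp add: N_def abs_minus_commute)
qed

text \<open>The odd weights arise when a square is written as a sum of odd numbers; the limit 6 is
  the constant in the second-moment bound of a step.\<close>

lemma sum_odd_geometric: "(\<Sum>i<D. (2 * real i + 1) / 2 ^ i) = 6 - (4 * real D + 6) / 2 ^ D"
proof (induction D)
  case (Suc D)
  have "(\<Sum>i<Suc D. (2 * real i + 1) / 2 ^ i) = 6 - (4 * real D + 6) / 2 ^ D + (2 * real D
    + 1) / 2 ^ D"
    using Suc.IH by simp
  also have "\<dots> = 6 - (4 * real (Suc D) + 6) / 2 ^ Suc D" by (simp add: field_simps)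
  finally show ?case .
qed simp

text \<open>The summands are nonnegative and, by Bernoulli's inequality, at most k / 2^i, so the
  tail is dominated by a geometric series.\<close>

lemma mu_tail: "0 \<le> mu k - (\<Sum>i<D. 1 - (1 - 1 / 2 ^ i) ^ k)"
  "mu k - (\<Sum>i<D. 1 - (1 - 1 / 2 ^ i) ^ k) \<le> 2 * real k / 2 ^ D"
proof -
  let ?f = "\<lambda>i. 1 - (1 - 1 / 2 ^ i) ^ k :: real"
  have eq: "mu k - (\<Sum>i<D. ?f i) = (\<Sum>i. ?f (i + D))"
    unfolding mu_def by (subst suminf_split_initial_segment[OF summable_mu, of k D]) simp
  have f0: "0 \<le> ?f i" for i using power_le_one[of "1 - 1 / 2 ^ i :: real" k] by auto
  have s: "summable (\<lambda>i. ?f (i + D))" by (intro summable_ignore_initial_segment summable_mu)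
  then show "0 \<le> mu k - (\<Sum>i<D. ?f i)" unfolding eq by (intro suminf_nonneg f0)
  have "?f i \<le> real k * (1 / 2) ^ i" for i
    using Bernoulli_inequality[of "- (1 / 2 ^ i) :: real" k] by (simp add: power_one_over)
  then have "?f (i + D) \<le> (k / 2 ^ D) * (1 / 2) ^ i" for i
    by (metis (no_types, lifting) power_add mult.assoc mult.commute power_one_over
      times_divide_eq_right mult.right_neutral)
  moreover have "summable (\<lambda>i. (k / 2 ^ D) * (1 / 2) ^ i :: real)"
    by (intro summable_mult summable_geometric) simp
  ultimately have "(\<Sum>i. ?f (i + D)) \<le> (\<Sum>i. (k / 2 ^ D) * (1 / 2) ^ i)"
    by (intro suminf_le s)
  also have "\<dots> = 2 * real k / 2 ^ D"
    by (subst suminf_mult) (auto simp: suminf_geometric summable_geometric)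
  finally show "mu k - (\<Sum>i<D. ?f i) \<le> 2 * real k / 2 ^ D" unfolding eq .
qed

text \<open>Layer-cake forms of the truncated advance and of its square: they reduce both moments of
  a step to the probabilities of getting beyond each level.\<close>

lemma real_min_diff_eq_sum:
  assumes "j < (m :: nat)"
  shows "real (min m (j + D)) - real j = (\<Sum>i<D. of_bool (m > j + i))"
    and "(real (min m (j + D)) - real j)\<^sup>2 = (\<Sum>i<D. (2 * real i + 1) * of_bool (m > j + i))"
proof -
  have "real (min m (j + D)) - real j = (\<Sum>i<D. of_bool (m > j + i))
    \<and> (real (min m (j + D)) - real j)\<^sup>2 = (\<Sum>i<D. (2 * real i + 1) * of_bool (m > j + i))"
  proof (induction D)
    case (Suc D)
    show ?case
    proof (cases "m > j + D")
      case True
      then have "min m (j + Suc D) = j + Suc D" "min m (j + D) = j + D" by auto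
      with Suc True show ?thesis by (simp add: power2_eq_square algebra_simps)
    next
      case False
      then have eq: "min m (j + Suc D) = min m (j + D)" "of_bool (m > j + D) = (0 :: real)"
        by auto
      show ?thesis unfolding eq sum.lessThan_Suc mult_zero_right add_0_right by (rule Suc)
    qed
  qed (use assms in simp)
  then show "real (min m (j + D)) - real j = (\<Sum>i<D. of_bool (m > j + i))"
    "(real (min m (j + D)) - real j)\<^sup>2 = (\<Sum>i<D. (2 * real i + 1) * of_bool (m > j + i))" by auto
qed

text \<open>The three errors come from sampling without replacement, from the densities of the levels, and
  from truncating the step at \<open>D\<close>.\<close>

lemma step_moments:
  fixes l :: "nat \<Rightarrow> nat" and best :: "nat set \<Rightarrow> nat"
  assumes "finite A" "1 \<le> k" "2 * k \<le> card A"
    and l: "\<And>m. m \<in> A \<Longrightarrow> j < l m"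
    and best: "\<And>S. S \<subseteq> A \<Longrightarrow> S \<noteq> {} \<Longrightarrow> best S \<in> S \<and> (\<forall>m\<in>S. l m \<le> l (best S))"
    and \<delta>: "0 \<le> \<delta>"
    and dens: "\<And>i. i < D \<Longrightarrow>
      \<bar>real (card {m \<in> A. j + i < l m}) / real (card A) - 1 / 2 ^ i\<bar> \<le> \<delta> / 2 ^ i"
  defines "K \<equiv> map_pmf best (bucket_pmf k A)"
  shows "\<bar>measure_pmf.expectation K (\<lambda>w. real (min (l w) (j + D)) - real j) - mu k\<bar>
      \<le> D * (2 * (real k)\<^sup>2 / real (card A)) + 2 * real k * \<delta> + 2 * real k / 2 ^ D"
    and "measure_pmf.expectation K (\<lambda>w. (real (min (l w) (j + D)) - real j)\<^sup>2)
      \<le> D\<^sup>2 * (2 * (real k)\<^sup>2 / real (card A)) + 6 * real k * (1 + \<delta>)"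
proof (goal_cases)
  let ?E = "measure_pmf.expectation" and ?P = "bucket_pmf k A"
  let ?B = "\<lambda>i. {m \<in> A. j + i < l m}"
  let ?w = "\<lambda>i. real (card (?B i)) / real (card A)"
  let ?q = "\<lambda>i. measure_pmf.prob ?P {S. S \<inter> ?B i \<noteq> {}}"
  let ?f = "\<lambda>i. 1 - (1 - 1 / 2 ^ i) ^ k :: real"
  let ?e = "2 * (real k)\<^sup>2 / real (card A)"
  have setP: "set_pmf ?P = {S. S \<subseteq> A \<and> card S = k}"
    using set_bucket_pmf[OF assms(1), of k] assms(3) by (simp add: min_absorb1)
  have finP: "finite (set_pmf ?P)" unfolding setP using assms by simp
  then have finK: "finite (set_pmf K)" by (simp add: K_def)
  have S: "S \<subseteq> A" "S \<noteq> {}" if "S \<in> set_pmf ?P" for S using that assms(2) by (auto simp: setP)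
  \<comment> \<open>As \<open>best\<close> picks a deepest entry, it gets beyond
    \<open>j + i\<close> exactly when some entry of the bucket does.\<close>
  have q: "?E K (\<lambda>w. of_bool (l w > j + i)) = ?q i" for i
  proof -
    have "?E K (\<lambda>w. of_bool (l w > j + i)) = ?E ?P (indicat_real {S. S \<inter> ?B i \<noteq> {}})"
      unfolding K_def integral_map_pmf
    proof (intro integral_cong_AE)
      show "AE S in ?P. of_bool (l (best S) > j + i) = indicat_real {S. S \<inter> ?B i \<noteq> {}} S"
        unfolding AE_measure_pmf_iff
      proof
        fix S' assume S': "S' \<in> set_pmf ?P"
        have "best S' \<in> S'" "\<forall>m\<in>S'. l m \<le> l (best S')" using best S[OF S'] by auto
        then have "l (best S') > j + i \<longleftrightarrow> S' \<inter> ?B i \<noteq> {}"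
          using S[OF S'] by (fastforce intro: less_le_trans)
        then show "of_bool (l (best S') > j + i) = indicat_real {S. S \<inter> ?B i \<noteq> {}} S'"
          by (simp add: indicator_def)
      qed
    qed auto
    then show ?thesis by simp
  qed
  have lK: "j < l w" if w: "w \<in> set_pmf K" for w
  proof -
    obtain S' where "S' \<in> set_pmf ?P" "w = best S'" using w unfolding K_def by auto
    then have "w \<in> A" using best[of S'] S[of S'] by blast
    then show ?thesis by (rule l)
  qed
  have intK: "integrable (measure_pmf K) (h :: nat \<Rightarrow> real)" for h
    using finK by (rule integrable_measure_pmf_finite)
  have E1: "?E K (\<lambda>w. real (min (l w) (j + D)) - real j) = (\<Sum>i<D. ?q i)"
  proof -
    have "?E K (\<lambda>w. real (min (l w) (j + D)) - real j) = ?E K (\<lambda>w. \<Sum>i<D. of_bool (l w > j + i))"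
      by (intro integral_cong_AE) (auto simp: AE_measure_pmf_iff real_min_diff_eq_sum(1) lK)
    also have "\<dots> = (\<Sum>i<D. ?q i)"
      by (subst Bochner_Integration.integral_sum) (simp_all only: intK q)
    finally show ?thesis .
  qed
  have E2: "?E K (\<lambda>w. (real (min (l w) (j + D)) - real j)\<^sup>2) = (\<Sum>i<D. (2 * real i + 1) * ?q i)"
  proof -
    have "?E K (\<lambda>w. (real (min (l w) (j + D)) - real j)\<^sup>2)
        = ?E K (\<lambda>w. \<Sum>i<D. (2 * real i + 1) * of_bool (l w > j + i))"
      by (intro integral_cong_AE) (auto simp: AE_measure_pmf_iff real_min_diff_eq_sum(2) lK)
    also have "\<dots> = (\<Sum>i<D. (2 * real i + 1) * ?q i)"
      by (subst Bochner_Integration.integral_sum) (simp_all only: intK q integral_mult_right_zero)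
    finally show ?thesis .
  qed
  have w01: "0 \<le> ?w i" "?w i \<le> 1" for i
    using card_mono[OF assms(1), of "?B i"] by (auto simp: divide_le_eq_1)
  have qw: "\<bar>?q i - (1 - (1 - ?w i) ^ k)\<bar> \<le> ?e" for i
    by (rule prob_bucket_hit) (use assms in auto)
  \<comment> \<open>The k-th power is k-Lipschitz on the unit interval. The relative form of
    \<open>dens\<close> keeps the errors summable over i.\<close>
  have wf: "\<bar>(1 - (1 - ?w i) ^ k) - ?f i\<bar> \<le> k * \<delta> / 2 ^ i" if "i < D" for i
  proof -
    have "\<bar>(1 - 1 / 2 ^ i) ^ k - (1 - ?w i) ^ k\<bar> \<le> k * \<bar>(1 - 1 / 2 ^ i) - (1 - ?w i)\<bar>"
      by (rule norm_power_diff[where 'a = real, unfolded real_norm_def])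
         (use w01[of i] in \<open>auto simp: abs_le_iff add_increasing\<close>)
    also have "\<dots> \<le> k * (\<delta> / 2 ^ i)"
      using dens[OF that] by (intro mult_left_mono) auto
    finally show ?thesis by simp
  qed
  have f0: "0 \<le> ?f i" "?f i \<le> k / 2 ^ i" for i
    using power_le_one[of "1 - 1 / 2 ^ i :: real" k] Bernoulli_inequality[of "- (1 / 2 ^ i) ::
      real" k] by auto
  case 1
  have geo: "(\<Sum>i<D. 1 / 2 ^ i :: real) \<le> 2"
    by (simp add: sum_gp_strict flip: power_one_over)
  have "\<bar>(\<Sum>i<D. ?q i) - (\<Sum>i<D. ?f i)\<bar> \<le> (\<Sum>i<D. \<bar>?q i - ?f i\<bar>)"
    unfolding sum_subtractf[symmetric] by (rule sum_abs)
  also have "\<dots> \<le> (\<Sum>i<D. ?e + k * \<delta> * (1 / 2 ^ i))"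
  proof (rule sum_mono)
    fix i assume "i \<in> {..<D}"
    then show "\<bar>?q i - ?f i\<bar> \<le> ?e + k * \<delta> * (1 / 2 ^ i)" using qw[of i] wf[of i] by simp
  qed
  also have "\<dots> = D * ?e + k * \<delta> * (\<Sum>i<D. 1 / 2 ^ i)" by (simp add: sum.distrib sum_distrib_left)
  also have "\<dots> \<le> D * ?e + k * \<delta> * 2"
    using \<delta> geo by (intro add_left_mono mult_left_mono) auto
  finally show ?case using mu_tail[of k D] \<delta> unfolding E1 by linarith
  case 2
  have "?q i \<le> ?e + k * (1 + \<delta>) * (1 / 2 ^ i)" if "i < D" for i
  proof -
    have "k * (1 + \<delta>) * (1 / 2 ^ i) = k / 2 ^ i + k * \<delta> / 2 ^ i" by (simp add: field_simps)
    then show ?thesis using qw[of i] wf[OF that] f0(2)[of i] by linarith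
  qed
  then have "(\<Sum>i<D. (2 * real i + 1) * ?q i)
      \<le> (\<Sum>i<D. (2 * real i + 1) * (?e + k * (1 + \<delta>) * (1 / 2 ^ i)))"
    by (intro sum_mono mult_left_mono) auto
  also have "\<dots> = ?e * (\<Sum>i<D. 2 * real i + 1) + k * (1 + \<delta>) * (\<Sum>i<D. (2 * real i + 1) / 2 ^ i)"
  proof -
    have "(2 * real i + 1) * (e + c * (1 / 2 ^ i))
      = e * (2 * real i + 1) + c * ((2 * real i + 1) / 2 ^ i)"
      for e c :: real and i by (simp add: algebra_simps add_divide_distrib)
    then show ?thesis by (simp only: sum_distrib_left sum.distrib[symmetric])
  qed
  also have "(\<Sum>i<D. 2 * real i + 1) = D\<^sup>2"
    by (induction D) (auto simp: power2_eq_square algebra_simps)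
  also have "k * (1 + \<delta>) * (\<Sum>i<D. (2 * real i + 1) / 2 ^ i) \<le> k * (1 + \<delta>) * 6"
    using \<delta> by (intro mult_left_mono) (auto simp: sum_odd_geometric)
  finally show ?case unfolding E2 by (simp add: algebra_simps)
qed

section \<open>The search for fixed IDs\<close>

lemma search_time_eqI: "search d y X B i t \<Longrightarrow> search_time d y i (X, B) = t"
  unfolding search_time_def by (auto intro: search_unique)

locale kademlia_ids =
  fixes k n d :: nat and y :: "bool list" and X :: "nat \<Rightarrow> bool list"
  assumes n: "n \<ge> 1" and d: "real d \<ge> log 2 (real n)" and y: "length y = d"
    and X: "X \<in> id_assignments n d"
begin

definition level :: "nat \<Rightarrow> nat" where
  "level m = lcp y (X m)"

text \<open>Below is meant in the prefix tree: larger levels are deeper and nearer to y.\<close>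

definition below :: "nat \<Rightarrow> nat set" where
  "below j = {m \<in> {1..n}. j \<le> level m}"

definition buckets :: "(nat \<times> nat \<Rightarrow> nat set) pmf" where
  "buckets = Pi_pmf ({1..n} \<times> {..<d}) {} (\<lambda>(i, j). bucket_pmf k (nodes_at n X (X i) j))"

definition law :: "nat \<Rightarrow> nat pmf" where
  "law i = map_pmf (\<lambda>B. search_time d y i (X, B)) buckets"

definition closest :: "nat set \<Rightarrow> nat" where
  "closest S = arg_min_on (\<lambda>m. xor_dist d (X m) y) S"

lemma length_X: "m \<in> {1..n} \<Longrightarrow> length (X m) = d"
  using X by (auto simp: id_assignments_def bitstrings_def)

lemma finite_below: "finite (below j)"
  by (simp add: below_def)

text \<open>\<open>lcp_step\<close> and \<open>lcp_eq_if_lt\<close> give the two inclusions. The set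
  from which the relevant bucket is drawn thus depends on i only through its level, which makes the
  levels drive the chain.\<close>

lemma nodes_at_eq_below:
  assumes "i \<in> {1..n}" "level i < d"
  shows "nodes_at n X (X i) (level i) = below (Suc (level i))"
proof -
  have "X i \<noteq> y" using assms(2) y le_lcp_iff[of d y y] by (auto simp: level_def)
  then show ?thesis
    using lcp_step[of "X i" y] lcp_eq_if_lt[of "X i" y] length_X assms(1) y
    by (auto simp: nodes_at_def below_def level_def Suc_le_eq)
qed

lemma closest:
  assumes "S \<subseteq> {1..n}" "S \<noteq> {}"
  shows "closest S \<in> S" "m \<in> S \<Longrightarrow> level m \<le> level (closest S)"
proof -
  have fin: "finite S" using assms(1) finite_subset by blast
  note am = arg_min_if_finite[OF fin assms(2), of "\<lambda>m. xor_dist d (X m) y"]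
  show c: "closest S \<in> S" unfolding closest_def by (rule am)
  show "level m \<le> level (closest S)" if "m \<in> S"
  proof (rule ccontr)
    assume "\<not> ?thesis"
    then have "xor_dist d (X m) y < xor_dist d (X (closest S)) y"
      using c that assms(1) length_X y
      by (intro xor_dist_less_if_lcp_less) (auto simp: level_def)
    then show False using am(2) that unfolding closest_def by blast
  qed
qed

lemma set_buckets_in_kademlia: "B \<in> set_pmf buckets \<Longrightarrow> (X, B) \<in> set_pmf (kademlia k n d)"
  using X set_pmf_of_set[OF id_assignments_nonempty[OF n d] finite_id_assignments]
  by (auto simp: kademlia_def buckets_def)

lemma set_bucketsD:
  assumes "B \<in> set_pmf buckets" "i \<in> {1..n}" "level i < d"
  shows "B (i, level i) \<subseteq> below (Suc (level i))"
    and "1 \<le> k \<Longrightarrow> below (Suc (level i)) \<noteq> {} \<Longrightarrow> B (i, level i) \<noteq> {}"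
proof -
  have "B (i, level i) \<in> set_pmf (bucket_pmf k (nodes_at n X (X i) (level i)))"
    using assms unfolding buckets_def by (subst (asm) set_Pi_pmf) (force simp: PiE_dflt_def)+
  then have B: "B (i, level i) \<subseteq> below (Suc (level i))"
      "card (B (i, level i)) = min k (card (below (Suc (level i))))"
    unfolding nodes_at_eq_below[OF assms(2,3)] set_bucket_pmf[OF finite_below] by auto
  show "B (i, level i) \<subseteq> below (Suc (level i))" by (rule B)
  show "B (i, level i) \<noteq> {}" if "1 \<le> k" "below (Suc (level i)) \<noteq> {}"
  proof
    assume "B (i, level i) = {}"
    then have "card (below (Suc (level i))) = 0" using B(2) that(1)
      by (simp add: min_def split: if_splits)
    then show False using that(2) finite_below by simp
  qed
qed

lemma level_less: "i \<in> {1..n} \<Longrightarrow> X i \<noteq> y \<Longrightarrow> level i < d"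
  using lcp_less[of "X i" y] length_X y by (simp add: level_def)

lemma closest_bucket:
  assumes "B \<in> set_pmf buckets" "i \<in> {1..n}" "X i \<noteq> y" "B (i, level i) \<noteq> {}"
  shows "closest (B (i, level i)) \<in> below (Suc (level i))"
proof -
  have sub: "B (i, level i) \<subseteq> below (Suc (level i))"
    using set_bucketsD(1)[OF assms(1,2) level_less] assms by simp
  then have "B (i, level i) \<subseteq> {1..n}" by (auto simp: below_def)
  from closest(1)[OF this assms(4)] sub show ?thesis by blast
qed

section \<open>Progress, locality and the Markov property of the search\<close>

lemma search_search_time:
  "B \<in> set_pmf buckets \<Longrightarrow> i \<in> {1..n} \<Longrightarrow> search d y X B i (search_time d y i (X, B))"
  using theI'[OF search_ex1[OF n d y set_buckets_in_kademlia]] by (simp add: search_time_def)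

text \<open>Each step raises the level by at least one. This crude bound serves both for the last
  levels and for the control of the mean.\<close>

lemma search_bound:
  assumes "search d y X B i t" "B \<in> set_pmf buckets" "i \<in> {1..n}"
    and M: "\<And>m. m \<in> {1..n} \<Longrightarrow> level m \<le> M"
  shows "t + level i \<le> M"
  using assms(1,3)
proof (induction rule: search.induct)
  case (step i t)
  from step.hyps step.prems have "closest (B (i, level i)) \<in> below (Suc (level i))"
    by (intro closest_bucket assms) (auto simp: level_def)
  with step.IH show ?case by (auto simp: below_def closest_def level_def)
qed (use M in auto)

text \<open>From m on, only buckets whose index is at least \<open>level m\<close> are read, so a
  bucket with a smaller index can be overwritten by anything.\<close>

lemma search_upd:
  assumes "search d y X B m t" "B \<in> set_pmf buckets" "m \<in> {1..n}" "l < level m"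
  shows "search d y X (B((i, l) := S)) m t"
  using assms(1,3,4)
proof (induction rule: search.induct)
  case (found m) then show ?case by (intro search.found)
next
  case (stuck m) then show ?case by (intro search.stuck) (auto simp: level_def)
next
  case (step m t)
  from step.hyps step.prems have "closest (B (m, level m)) \<in> below (Suc (level m))"
    by (intro closest_bucket assms) (auto simp: level_def)
  then have "search d y X (B((i, l) := S)) (closest (B (m, level m))) t"
    using step.IH step.prems
      by (auto simp: below_def closest_def level_def simp del: fun_upd_apply)
  moreover have "(B((i, l) := S)) (m, level m) = B (m, level m)"
    using step.prems by simp
  ultimately show ?case
    using step.hyps by (intro search.step) (simp_all add: closest_def level_def del:
      fun_upd_apply)
qed

lemma finite_set_buckets: "finite (set_pmf buckets)"
proof -
  have "finite (nodes_at n X (X i) j)" for i j by (simp add: nodes_at_def)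
  then show ?thesis unfolding buckets_def
    by (subst set_Pi_pmf) (auto intro!: finite_PiE_dflt simp: set_bucket_pmf)
qed

lemma finite_set_law: "finite (set_pmf (law i))"
  using finite_set_buckets by (simp add: law_def)

lemma set_law_bound:
  assumes "i \<in> {1..n}" "t \<in> set_pmf (law i)" "\<And>m. m \<in> {1..n} \<Longrightarrow> level m \<le> M"
  shows "t + level i \<le> M"
  using assms search_bound[OF search_search_time] by (auto simp: law_def)

text \<open>The Markov property, by deferred decisions: the bucket read at i is split off the
  product, and by \<open>search_upd\<close> the rest of the search never reads it again, so from
  \<open>closest S\<close> it behaves like a fresh search.\<close>

lemma law_step:
  assumes "1 \<le> k" and i: "i \<in> {1..n}" and l: "level i < d" and ne: "below (Suc (level i)) \<noteq> {}"
  shows "law i = bind_pmf (map_pmf closest (bucket_pmf k (below (Suc (level i)))))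
    (\<lambda>m. map_pmf Suc (law m))"
proof -
  let ?x = "(i, level i)" and ?T = "\<lambda>m B. search_time d y m (X, B)"
  let ?I = "{1..n} \<times> {..<d} - {(i, level i)}"
  let ?P = "Pi_pmf ?I {} (\<lambda>(i, j). bucket_pmf k (nodes_at n X (X i) j))"
  let ?p = "bucket_pmf k (below (Suc (level i)))"
  have buckets: "buckets = bind_pmf ?p (\<lambda>S. bind_pmf ?P (\<lambda>B. return_pmf (B(?x := S))))"
  proof -
    have "insert ?x ?I = {1..n} \<times> {..<d}" using i l by auto
    then show ?thesis
      using Pi_pmf_insert'[of ?I ?x "{}" "\<lambda>(i, j). bucket_pmf k (nodes_at n X (X i) j)"]
      unfolding buckets_def by (simp add: nodes_at_eq_below[OF i l])
  qed
  have supp: "B(?x := S) \<in> set_pmf buckets" if "S \<in> set_pmf ?p" "B \<in> set_pmf ?P" for B S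
    using that unfolding buckets by auto
  have S: "S \<subseteq> {1..n}" "closest S \<in> {1..n}" "level i < level (closest S)" "S \<noteq> {}"
    if "S \<in> set_pmf ?p" for S
  proof -
    \<comment> \<open>The support facts concern complete families of buckets, so S is completed by
      an arbitrary choice of the others.\<close>
    obtain B where B: "B \<in> set_pmf ?P" using set_pmf_not_empty[of ?P] by blast
    note SB = set_bucketsD[OF supp[OF that B] i l]
    then show 1: "S \<noteq> {}" "S \<subseteq> {1..n}" using assms(1) ne by (auto simp: below_def)
    show "closest S \<in> {1..n}" "level i < level (closest S)"
      using closest(1)[OF 1(2,1)] SB(1) by (auto simp: below_def)
  qed
  have noty: "X i \<noteq> y" using l y le_lcp_iff[of d y y] by (auto simp: level_def)
  have indep: "?T m (B(?x := S)) = ?T m (B(?x := S'))"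
    if "S \<in> set_pmf ?p" "S' \<in> set_pmf ?p" "B \<in> set_pmf ?P" "m \<in> {1..n}" "level i < level m"
    for S S' m B
    using search_upd[OF search_search_time[OF supp[OF that(1,3)] that(4)] supp[OF that(1,3)]
      that(4,5), of i S']
    by (simp add: search_time_eqI)
  have law_closest: "law (closest S) = map_pmf (\<lambda>B. ?T (closest S) (B(?x := S))) ?P"
    if Sp: "S \<in> set_pmf ?p" for S
  proof -
    \<comment> \<open>The bucket at \<open>?x\<close> is drawn last; by \<open>indep\<close> it can
      then be frozen at S, the very bucket that selected the starting point.\<close>
    have "law (closest S) = bind_pmf ?P (\<lambda>B. bind_pmf ?p
      (\<lambda>S'. return_pmf (?T (closest S) (B(?x := S')))))"
      unfolding law_def buckets map_bind_pmf by (subst bind_commute_pmf) simp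
    also have "\<dots> = bind_pmf ?P (\<lambda>B. bind_pmf ?p (\<lambda>S'. return_pmf (?T (closest S) (B(?x := S)))))"
      by (intro bind_pmf_cong refl) (use indep[OF _ Sp _ S(2,3)[OF Sp]] in simp)
    finally show ?thesis by (simp add: map_pmf_def)
  qed
  have "law i = bind_pmf ?p (\<lambda>S. bind_pmf ?P (\<lambda>B. return_pmf (?T i (B(?x := S)))))"
    unfolding law_def buckets map_bind_pmf by simp
  also have "\<dots> = bind_pmf ?p (\<lambda>S. bind_pmf ?P
    (\<lambda>B. return_pmf (Suc (?T (closest S) (B(?x := S))))))"
  proof (intro bind_pmf_cong refl)
    fix S B assume SB: "S \<in> set_pmf ?p" "B \<in> set_pmf ?P"
    have "search d y X (B(?x := S)) (closest S) (?T (closest S) (B(?x := S)))"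
      using search_search_time[OF supp[OF SB] S(2)[OF SB(1)]] .
    then have "search d y X (B(?x := S)) i (Suc (?T (closest S) (B(?x := S))))"
      using noty S(4)[OF SB(1)] by (intro search.step) (auto simp: level_def closest_def)
    then show "return_pmf (?T i (B(?x := S))) = return_pmf (Suc (?T (closest S) (B(?x := S))))"
      by (simp add: search_time_eqI)
  qed
  also have "\<dots> = bind_pmf ?p (\<lambda>S. map_pmf Suc (law (closest S)))"
    by (intro bind_pmf_cong refl) (simp add: law_closest pmf.map_comp o_def map_pmf_def
      bind_assoc_pmf bind_return_pmf)
  finally show ?thesis by (simp add: bind_map_pmf)
qed

end

section \<open>Random IDs\<close>

lemma prob_ge_le_expectation:
  assumes "finite (set_pmf p)" "\<And>x. 0 \<le> f x" "0 < c"
  shows "measure_pmf.prob p {x. c \<le> f x} \<le> measure_pmf.expectation p f / c"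
proof -
  have "measure_pmf.prob p {x. c \<le> f x} = measure_pmf.expectation p (indicat_real {x. c \<le> f x})"
    by simp
  also have "\<dots> \<le> measure_pmf.expectation p (\<lambda>x. f x / c)"
    by (rule expectation_mono_finite) (use assms in \<open>auto simp: indicator_def\<close>)
  finally show ?thesis by simp
qed

lemma expectation_of_bool: "measure_pmf.expectation p (\<lambda>x. of_bool (P x))
  = measure_pmf.prob p {x. P x}"
proof -
  have "(\<lambda>x. of_bool (P x)) = indicat_real {x. P x}" by (auto simp: indicator_def)
  then show ?thesis by simp
qed

locale id_space =
  fixes n d :: nat
  assumes n: "n \<ge> 1" and d: "real d \<ge> log 2 (real n)"
begin

definition ids :: "(nat \<Rightarrow> bool list) pmf" where
  "ids = pmf_of_set (id_assignments n d)"

lemma set_ids: "set_pmf ids = id_assignments n d"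
  unfolding ids_def by (intro set_pmf_of_set id_assignments_nonempty finite_id_assignments n d)

lemma finite_set_ids: "finite (set_pmf ids)"
  unfolding set_ids by (rule finite_id_assignments)

lemma ids_in: "X \<in> set_pmf ids \<Longrightarrow> i \<in> {1..n} \<Longrightarrow> X i \<in> bitstrings d"
  by (auto simp: set_ids id_assignments_def)

text \<open>Exchanging u and v in all IDs is an involution on the injective assignments. This
  symmetry yields the one- and two-point laws of the IDs without counting injections;
  \<open>restrict\<close> keeps the functions extensional.\<close>

lemma map_transpose_ids:
  assumes "u \<in> bitstrings d" "v \<in> bitstrings d"
  shows "map_pmf (\<lambda>X. restrict (Transposition.transpose u v \<circ> X) {1..n}) ids = ids"
  unfolding ids_def
proof (rule map_pmf_of_set_bij_betw)
  let ?f = "\<lambda>X. restrict (Transposition.transpose u v \<circ> X) {1..n}"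
  have t: "Transposition.transpose u v x \<in> bitstrings d" if "x \<in> bitstrings d" for x
    using assms that by (auto simp: Transposition.transpose_def)
  have f: "?f X \<in> id_assignments n d \<and> ?f (?f X) = X" if "X \<in> id_assignments n d" for X
  proof
    have inj: "inj_on (Transposition.transpose u v \<circ> X) {1..n}"
      using that by (intro comp_inj_on) (auto simp: id_assignments_def intro: inj_on_subset[OF
        inj_transpose])
    show "?f X \<in> id_assignments n d"
      using that inj by (auto simp: id_assignments_def inj_on_restrict_eq intro!: t)
    show "?f (?f X) = X"
      using that by (intro extensionalityI[of _ "{1..n}"]) (auto simp: id_assignments_def PiE_iff)
  qed
  show "bij_betw ?f (id_assignments n d) (id_assignments n d)"
    by (rule bij_betw_byWitness[where f' = ?f]) (use f in blast)+
qed (intro id_assignments_nonempty finite_id_assignments n d)+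

lemma pmf_id:
  assumes i: "i \<in> {1..n}" and u: "u \<in> bitstrings d"
  shows "pmf (map_pmf (\<lambda>X. X i) ids) u = 1 / 2 ^ d"
proof -
  let ?q = "map_pmf (\<lambda>X. X i) ids"
  have eq: "pmf ?q v = pmf ?q u" if "v \<in> bitstrings d" for v
  proof -
    have "?q = map_pmf (\<lambda>X. X i) (map_pmf (\<lambda>X. restrict (Transposition.transpose u v \<circ> X)
      {1..n}) ids)"
      using map_transpose_ids[OF u that] by simp
    also have "\<dots> = map_pmf (Transposition.transpose u v) ?q"
      using i by (simp add: pmf.map_comp o_def)
    finally have "pmf ?q v = pmf (map_pmf (Transposition.transpose u v) ?q)
      (Transposition.transpose u v u)" by simp
    also have "\<dots> = pmf ?q u" by (rule pmf_map_inj') (rule inj_transpose)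
    finally show ?thesis .
  qed
  have "(\<Sum>v\<in>bitstrings d. pmf ?q v) = 1"
    by (rule sum_pmf_eq_1) (use finite_bitstrings ids_in i in auto)
  then have "2 ^ d * pmf ?q u = 1" by (simp add: eq card_bitstrings)
  then show ?thesis by (simp add: field_simps)
qed

lemma prob_id:
  assumes i: "i \<in> {1..n}" and U: "U \<subseteq> bitstrings d"
  shows "measure_pmf.prob ids {X. X i \<in> U} = card U / 2 ^ d"
proof -
  have "measure_pmf.prob ids {X. X i \<in> U} = measure_pmf.prob (map_pmf (\<lambda>X. X i) ids) U"
    by (simp add: vimage_def)
  also have "\<dots> = (\<Sum>u\<in>U. 1 / 2 ^ d)"
    using U finite_subset[OF U finite_bitstrings]
    by (simp add: measure_measure_pmf_finite pmf_id[OF i] subset_iff cong: sum.cong del: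
      measure_map_pmf)
  finally show ?thesis by simp
qed

lemma pmf_id_pair_eq:
  assumes "i \<in> {1..n}" "m \<in> {1..n}" "i \<noteq> m"
  shows "pmf (map_pmf (\<lambda>X. (X i, X m)) ids) (a, a) = 0"
proof -
  have "X i \<noteq> X m" if "X \<in> set_pmf ids" for X
    using that assms unfolding set_ids id_assignments_def mem_Collect_eq by (metis inj_onD)
  then show ?thesis unfolding pmf_eq_0_set_pmf by auto
qed

text \<open>Exchanging u with any v other than a fixes a, so given the first ID a the second is
  uniform on the remaining 2^d - 1 strings; summing over them recovers the law of the first
  ID.\<close>

lemma pmf_id_pair:
  assumes i: "i \<in> {1..n}" and m: "m \<in> {1..n}" "i \<noteq> m"
    and u: "a \<in> bitstrings d" "u \<in> bitstrings d" "a \<noteq> u"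
  shows "(2 ^ d - 1) * pmf (map_pmf (\<lambda>X. (X i, X m)) ids) (a, u) = 1 / 2 ^ d"
proof -
  let ?q = "map_pmf (\<lambda>X. (X i, X m)) ids"
  have eq: "pmf ?q (a, v) = pmf ?q (a, u)" if "v \<in> bitstrings d - {a}" for v
  proof -
    let ?t = "map_prod (Transposition.transpose u v) (Transposition.transpose u v)"
    have "?q = map_pmf (\<lambda>X. (X i, X m)) (map_pmf
      (\<lambda>X. restrict (Transposition.transpose u v \<circ> X) {1..n}) ids)"
      using map_transpose_ids[OF u(2), of v] that by simp
    also have "\<dots> = map_pmf ?t ?q"
      using i m by (simp add: pmf.map_comp o_def)
    finally have "pmf ?q (a, v) = pmf (map_pmf ?t ?q) (a, v)" by (rule arg_cong)
    moreover have "?t (a, u) = (a, v)" using that u by (auto simp: Transposition.transpose_def)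
    moreover have "pmf (map_pmf ?t ?q) (?t (a, u)) = pmf ?q (a, u)"
      by (rule pmf_map_inj') (intro prod.inj_map inj_transpose)
    ultimately show ?thesis by (simp only:)
  qed
  note aa = pmf_id_pair_eq[OF i m]
  have "pmf (map_pmf (\<lambda>X. X i) ids) a = pmf (map_pmf fst ?q) a" by (simp add: pmf.map_comp o_def)
  also have "\<dots> = measure_pmf.prob ?q (fst -` {a} \<inter> set_pmf ?q)"
    unfolding pmf_map[of fst] by (rule measure_Int_set_pmf[symmetric])
  also have "fst -` {a} \<inter> set_pmf ?q = (Pair a ` bitstrings d) \<inter> set_pmf ?q"
    using ids_in m by auto
  also have "measure_pmf.prob ?q \<dots> = (\<Sum>v\<in>bitstrings d. pmf ?q (a, v))"
    using finite_bitstrings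
    by (simp add: measure_Int_set_pmf measure_measure_pmf_finite sum.reindex inj_on_def del:
      measure_map_pmf set_map_pmf)
  also have "\<dots> = (\<Sum>v\<in>bitstrings d - {a}. pmf ?q (a, v))"
    using u finite_bitstrings aa by (subst sum.remove[of _ a]) auto
  also have "\<dots> = (2 ^ d - 1) * pmf ?q (a, u)"
    using u finite_bitstrings
    by (subst sum.cong[OF refl eq]) (simp_all add: card_bitstrings of_nat_diff)
  finally show ?thesis using pmf_id[OF i u(1)] by simp
qed

text \<open>Negative correlation of sampling without replacement: with c = card U and D = 2^d, the
  exact value c (c - 1) / (D (D - 1)) is at most (c / D)^2 because c is at most D.\<close>

lemma prob_id_pair_le:
  assumes i: "i \<in> {1..n}" and m: "m \<in> {1..n}" "i \<noteq> m" and U: "U \<subseteq> bitstrings d"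
  shows "measure_pmf.prob ids {X. X i \<in> U \<and> X m \<in> U} \<le> (card U / 2 ^ d)\<^sup>2"
proof -
  let ?q = "map_pmf (\<lambda>X. (X i, X m)) ids"
  let ?D = "2 ^ d :: real"
  have fU: "finite U" using finite_subset[OF U finite_bitstrings] .
  note aa = pmf_id_pair_eq[OF i m]
  have "measure_pmf.prob ids {X. X i \<in> U \<and> X m \<in> U} = measure_pmf.prob ?q (U \<times> U)"
    by (simp add: vimage_def)
  also have "\<dots> = (\<Sum>a\<in>U. \<Sum>u\<in>U. pmf ?q (a, u))"
    using fU by (simp add: measure_measure_pmf_finite sum.cartesian_product del: measure_map_pmf)
  also have "\<dots> = (\<Sum>a\<in>U. \<Sum>u\<in>U - {a}. pmf ?q (a, u))"
  proof (rule sum.cong[OF refl])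
    fix a assume "a \<in> U"
    then show "(\<Sum>u\<in>U. pmf ?q (a, u)) = (\<Sum>u\<in>U - {a}. pmf ?q (a, u))"
      using fU by (subst sum.remove[of U a]) (simp_all only: aa add_0_left)
  qed
  finally have eq: "measure_pmf.prob ids {X. X i \<in> U \<and> X m \<in> U}
    = (\<Sum>a\<in>U. \<Sum>u\<in>U - {a}. pmf ?q (a, u))" .
  have le: "real (card U) \<le> ?D"
    using of_nat_mono[OF card_mono[OF finite_bitstrings U], where 'a = real]
      by (simp add: card_bitstrings)
  have "(?D - 1) * measure_pmf.prob ids {X. X i \<in> U \<and> X m \<in> U}
      = (\<Sum>a\<in>U. \<Sum>u\<in>U - {a}. (?D - 1) * pmf ?q (a, u))"
    unfolding eq by (simp add: sum_distrib_left)
  also have "\<dots> = (\<Sum>a\<in>U. \<Sum>u\<in>U - {a}. 1 / ?D)"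
    by (intro sum.cong refl pmf_id_pair i m) (use U in auto)
  also have "\<dots> = real (card U) * (real (card U) - 1) / ?D"
    using fU by (cases "U = {}") (simp_all add: card_Diff_singleton of_nat_diff Suc_le_eq
      card_gt_0_iff)
  also have "\<dots> \<le> (?D - 1) * (real (card U) / ?D)\<^sup>2"
  proof -
    have "(?D - 1) * (real (card U) / ?D)\<^sup>2 - real (card U) * (real (card U) - 1) / ?D
        = real (card U) * (?D - real (card U)) / ?D\<^sup>2"
      by (simp add: field_simps power2_eq_square)
    also have "\<dots> \<ge> 0" using le by simp
    finally show ?thesis by simp
  qed
  finally have "(?D - 1) * measure_pmf.prob ids {X. X i \<in> U \<and> X m \<in> U}
    \<le> (?D - 1) * (real (card U) / ?D)\<^sup>2" .
  \<comment> \<open>Two distinct nodes force n > 1 and hence d > 0, so the factor 2^d - 1 can be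
    cancelled.\<close>
  moreover have "1 < ?D"
  proof -
    have "1 < n" using i m by auto
    then have "0 < log 2 (real n)" by simp
    then have "0 < d" using d by simp
    then show ?thesis by simp
  qed
  ultimately show ?thesis by simp
qed

section \<open>Moments of the number of nodes with ID in a given set\<close>

definition visits :: "bool list set \<Rightarrow> (nat \<Rightarrow> bool list) \<Rightarrow> nat" where
  "visits U X = card {i \<in> {1..n}. X i \<in> U}"

lemma real_visits: "real (visits U X) = (\<Sum>i\<in>{1..n}. of_bool (X i \<in> U))"
  by (simp add: visits_def Int_def)

lemma integrable_ids: "integrable (measure_pmf ids) (h :: _ \<Rightarrow> real)"
  using finite_set_ids by (rule integrable_measure_pmf_finite)

lemma expectation_visits:
  assumes "U \<subseteq> bitstrings d"
  shows "measure_pmf.expectation ids (\<lambda>X. real (visits U X)) = n * (card U / 2 ^ d)"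
  unfolding real_visits
  by (subst Bochner_Integration.integral_sum)
     (simp_all add: integrable_ids expectation_of_bool prob_id[OF _ assms])

text \<open>The pair bound makes covariances nonpositive, so the variance is at most the sum of the
  individual probabilities.\<close>

lemma variance_visits_le:
  fixes p :: real
  assumes "U \<subseteq> bitstrings d"
  defines "p \<equiv> real (card U) / 2 ^ d"
  shows "measure_pmf.expectation ids (\<lambda>X. (real (visits U X) - n * p)\<^sup>2) \<le> n * p"
proof -
  let ?E = "measure_pmf.expectation ids" and ?N = "\<lambda>X. real (visits U X)"
  have "?E (\<lambda>X. (?N X)\<^sup>2) = ?E (\<lambda>X. \<Sum>i\<in>{1..n}. \<Sum>m\<in>{1..n}. of_bool (X i \<in> U \<and> X m \<in> U))"
    by (simp add: real_visits power2_eq_square sum_product of_bool_conj del: sum_of_bool_eq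
      sum_mult_of_bool_eq sum_of_bool_mult_eq)
  also have "\<dots> = (\<Sum>i\<in>{1..n}. \<Sum>m\<in>{1..n}. measure_pmf.prob ids {X. X i \<in> U \<and> X m \<in> U})"
    by (subst Bochner_Integration.integral_sum integrable_ids, rule integrable_ids)+
       (simp only: expectation_of_bool)
  \<comment> \<open>The diagonal terms, equal to p, are weakened to p + p^2 so that the squares add
    up to exactly (n p)^2.\<close>
  also have "\<dots> \<le> (\<Sum>i\<in>{1..n}. \<Sum>m\<in>{1..n}. of_bool (i = m) * p + p\<^sup>2)"
  proof (intro sum_mono)
    fix i m assume im: "i \<in> {1..n}" "m \<in> {1..n}"
    show "measure_pmf.prob ids {X. X i \<in> U \<and> X m \<in> U} \<le> of_bool (i = m) * p + p\<^sup>2"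
      using prob_id[OF im(1) assms(1)] prob_id_pair_le[OF im(1,2) _ assms(1)]
      by (cases "i = m") (simp_all add: p_def)
  qed
  also have "\<dots> = n * p + (n * p)\<^sup>2"
    by (simp add: sum.distrib power2_eq_square algebra_simps sum_distrib_right[symmetric])
  finally have 2: "?E (\<lambda>X. (?N X)\<^sup>2) \<le> n * p + (n * p)\<^sup>2" .
  have "?E (\<lambda>X. (?N X - n * p)\<^sup>2) = ?E (\<lambda>X. (?N X)\<^sup>2 - 2 * (n * p) * ?N X + (n * p)\<^sup>2)"
    by (simp add: power2_diff algebra_simps)
  also have "\<dots> = ?E (\<lambda>X. (?N X)\<^sup>2) - 2 * (n * p) * ?E ?N + (n * p)\<^sup>2"
    using integrable_ids by simp
  also have "?E ?N = n * p" unfolding p_def by (rule expectation_visits[OF assms(1)])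
  finally show ?thesis using 2 by (simp add: power2_eq_square mult_ac)
qed

lemma prob_visits_deviation:
  fixes p :: real
  assumes "U \<subseteq> bitstrings d" "U \<noteq> {}" "0 < \<eta>"
  defines "p \<equiv> real (card U) / 2 ^ d"
  shows "measure_pmf.prob ids {X. \<eta> * (n * p) \<le> \<bar>real (visits U X) - n * p\<bar>}
    \<le> 1 / (\<eta>\<^sup>2 * (n * p))"
proof -
  have "0 < p" using assms finite_subset[OF assms(1) finite_bitstrings]
    by (simp add: p_def card_gt_0_iff)
  then have np: "0 < n * p" using n by simp
  then have "{X. \<eta> * (n * p) \<le> \<bar>real (visits U X) - n * p\<bar>}
     = {X. (\<eta> * (n * p))\<^sup>2 \<le> (real (visits U X) - n * p)\<^sup>2}"
    using assms(3) \<open>0 < p\<close> by (simp add: abs_le_square_iff[symmetric] abs_mult)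
  then have "measure_pmf.prob ids {X. \<eta> * (n * p) \<le> \<bar>real (visits U X) - n * p\<bar>}
     \<le> measure_pmf.expectation ids (\<lambda>X. (real (visits U X) - n * p)\<^sup>2) / (\<eta> * (n * p))\<^sup>2"
    using prob_ge_le_expectation[OF finite_set_ids, of "\<lambda>X. (real (visits U X) - n * p)\<^sup>2" "(\<eta>
      * (n * p))\<^sup>2"]
     n \<open>0 < p\<close> assms(3) by simp
  also have "\<dots> \<le> n * p / (\<eta> * (n * p))\<^sup>2"
    using variance_visits_le[OF assms(1)] by (intro divide_right_mono) (auto simp: p_def)
  also have "\<dots> = 1 / (\<eta>\<^sup>2 * (n * p))"
    using np by (simp add: power2_eq_square field_simps)
  finally show ?thesis .
qed

end

section \<open>Search time for typical IDs\<close>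

text \<open>The errors of a and of b * s add up to 2 * \<eta> * x * s, and dividing by b, which is
  at least x / 2, doubles the constant.\<close>

lemma ratio_close:
  fixes a b x s \<eta> :: real
  assumes "0 < x" "0 \<le> s" "0 \<le> \<eta>" "\<eta> \<le> 1 / 2"
    and b: "\<bar>b - x\<bar> \<le> \<eta> * x" and a: "\<bar>a - x * s\<bar> \<le> \<eta> * (x * s)"
  shows "\<bar>a / b - s\<bar> \<le> 4 * \<eta> * s"
proof -
  have "\<eta> * x \<le> 1 / 2 * x" using assms by (intro mult_right_mono) auto
  then have b2: "x / 2 \<le> b" using b by simp
  then have b0: "0 < b" using \<open>0 < x\<close> by linarith
  have "\<bar>a - b * s\<bar> \<le> \<bar>a - x * s\<bar> + \<bar>(b - x) * s\<bar>" by (simp add: algebra_simps)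
  also have "\<bar>(b - x) * s\<bar> \<le> \<eta> * x * s" using b \<open>0 \<le> s\<close> by (simp add: abs_mult mult_right_mono)
  also note a
  also have "\<eta> * (x * s) + \<eta> * x * s = 4 * \<eta> * s * (x / 2)" by simp
  also have "\<dots> \<le> 4 * \<eta> * s * b" using b2 assms by (intro mult_left_mono) auto
  finally have "\<bar>a - b * s\<bar> / b \<le> 4 * \<eta> * s" using b0 by (simp add: field_simps)
  moreover have "\<bar>a / b - s\<bar> = \<bar>a - b * s\<bar> / b"
  proof -
    have "a / b - s = (a - b * s) / b" using b0 by (simp add: field_simps)
    then show ?thesis using b0 by (simp add: abs_divide)
  qed
  ultimately show ?thesis by simp
qed

lemma square_le_two_power: "(real D)\<^sup>2 \<le> 2 * 2 ^ D"
proof (induction D)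
  case (Suc D)
  have "real D + 1 \<le> 2 ^ D"
    using less_exp[of D] by (metis Suc_leI of_nat_Suc of_nat_le_iff of_nat_numeral of_nat_power
      add.commute)
  then show ?case using Suc by (simp add: power2_eq_square algebra_simps)
qed simp

lemma mu_ge_one: "1 \<le> k \<Longrightarrow> 1 \<le> mu k"
  using mu_tail(1)[of k 1] by (cases k) simp_all

text \<open>The margin \<open>r\<close> plays three roles: level sizes up to \<open>log 2 n - r\<close> are known up to a factor
  \<open>1 \<plusminus> 1 / r\<close>, no level \<open>log 2 n + r\<close> is occupied, and the last \<open>2 * r\<close> levels are left to a
  crude bound.\<close>

definition drift_error :: "nat \<Rightarrow> nat \<Rightarrow> real" where
  "drift_error k r = 8 * (real k)\<^sup>2 / 2 ^ r + 8 * real k / real r + 2 * real k / 2 ^ r"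

text \<open>Bounds the square of \<open>mu k\<close> minus the advance by twice the sum of the
  squares; the mean squared advance is at most 2 * k^2 + 18 * k.\<close>

definition step_var :: "nat \<Rightarrow> real" where
  "step_var k = 2 * (mu k)\<^sup>2 + 4 * (real k)\<^sup>2 + 36 * real k"

text \<open>From level \<open>L - 2 * r\<close> to the top level \<open>L + r\<close> there are at
  most 3 * r steps, and the starting level is at most r short of \<open>L - r\<close>.\<close>

definition end_error :: "nat \<Rightarrow> nat \<Rightarrow> real" where
  "end_error k r = 3 * r * mu k + r"

lemma step_var_ge_one: "1 \<le> k \<Longrightarrow> 1 \<le> step_var k"
proof -
  assume "1 \<le> k"
  then have "1 \<le> real k" "0 \<le> (real k)\<^sup>2" "0 \<le> (mu k)\<^sup>2" by simp_all
  then show ?thesis unfolding step_var_def by linarith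
qed

lemma drift_error_nonneg: "0 \<le> drift_error k r"
  by (simp add: drift_error_def)

context kademlia_ids
begin

text \<open>The last clause keeps node 1 near the root of the prefix tree, so that its own level
  shifts the distance to be covered by less than r.\<close>

definition good :: "nat \<Rightarrow> nat \<Rightarrow> bool" where
  "good L r \<longleftrightarrow> (\<forall>j\<le>L - r. \<bar>real (card (below j)) - real n / 2 ^ j\<bar> \<le> 1 / real r * (real n / 2 ^ j))
     \<and> below (L + r) = {} \<and> level 1 < r"

lemma step_kernel:
  assumes g: "good L r" and k: "1 \<le> k" and r: "k + 3 \<le> r" and L: "2 * r \<le> L" "2 ^ L \<le> n"
    and v: "v \<in> {1..n}" "level v < L - 2 * r"
  defines "J \<equiv> L - r"
  defines "K \<equiv> map_pmf closest (bucket_pmf k (below (Suc (level v))))"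
  shows "below (Suc (level v)) \<noteq> {}"
    and "finite (set_pmf K)"
    and "w \<in> set_pmf K \<Longrightarrow> w \<in> {1..n} \<and> level v < level w"
    and "\<bar>measure_pmf.expectation K (\<lambda>w. mu k - (real (min (level w) J) - real (level v)))\<bar>
      \<le> drift_error k r"
    and "measure_pmf.expectation K (\<lambda>w. (mu k - (real (min (level w) J) - real (level v)))\<^sup>2)
      \<le> step_var k"
proof -
  define j where "j = level v"
  define D where "D = J - j"
  define A where "A = below (Suc j)"
  define \<eta> where "\<eta> = 1 / real r"
  let ?E = "measure_pmf.expectation"
  \<comment> \<open>Here the gap between stopping and truncation level pays off: at least r levels
    remain visible ahead of v.\<close>
  have D: "j + D = J" "r \<le> D" "L = j + D + r" using v L by (auto simp: D_def J_def j_def)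
  have \<eta>: "0 \<le> \<eta>" "\<eta> \<le> 1 / 2" using r k by (auto simp: \<eta>_def field_simps)
  have dev: "\<bar>real (card (below i)) - real n / 2 ^ i\<bar> \<le> \<eta> * (real n / 2 ^ i)" if "i \<le> J" for i
    using g that by (auto simp: good_def J_def \<eta>_def)
  have n0: "0 < real n" using n by simp
  define x where "x = real n / 2 ^ Suc j"
  have "\<eta> * x \<le> 1 / 2 * x"
    using \<eta> n0 by (intro mult_right_mono) (auto simp: x_def)
  moreover have "\<bar>real (card A) - x\<bar> \<le> \<eta> * x"
    unfolding A_def x_def using D r k by (intro dev) linarith
  ultimately have "x / 2 \<le> real (card A)" by linarith
  moreover have "(2 ^ (D + r) :: real) / 4 = 2 ^ L / 2 ^ Suc j / 2"
    unfolding D(3) by (simp add: power_add)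
  moreover have "(2 ^ L :: real) / 2 ^ Suc j / 2 \<le> x / 2"
    unfolding x_def
    using L(2) by (intro divide_right_mono) (simp_all flip: of_nat_power)
  ultimately have N: "2 ^ (D + r) / 4 \<le> real (card A)" by linarith
  \<comment> \<open>The origin of \<open>k + 3 \<le> r\<close>: it makes the candidate set large
    enough for full buckets and for \<open>prob_bucket_hit\<close>.\<close>
  have "2 * real k \<le> 2 ^ (D + r) / 4"
  proof -
    have "real k \<le> 2 ^ k" using less_exp[of k] by (simp flip: of_nat_power)
    then have "2 * real k \<le> 2 ^ (k + 3) / 4" by (simp add: power_add)
    also have "\<dots> \<le> 2 ^ (D + r) / 4" using r by (intro divide_right_mono power_increasing) auto
    finally show ?thesis .
  qed
  with N have "real (2 * k) \<le> real (card A)" by simp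
  then have kA: "2 * k \<le> card A" by (simp only: of_nat_le_iff)
  show "below (Suc (level v)) \<noteq> {}" using kA k by (auto simp: A_def j_def)
  have fA: "finite A" "A \<subseteq> {1..n}" "\<And>m. m \<in> A \<Longrightarrow> j < level m"
    by (auto simp: A_def finite_below) (auto simp: below_def)
  have sP: "set_pmf (bucket_pmf k A) = {S. S \<subseteq> A \<and> card S = k}"
    using set_bucket_pmf[OF fA(1), of k] kA by (simp add: min_absorb1)
  have Keq: "K = map_pmf closest (bucket_pmf k A)" by (simp add: K_def A_def j_def)
  show fK: "finite (set_pmf K)" unfolding Keq using sP fA(1) by simp
  have cl: "S \<subseteq> A \<Longrightarrow> S \<noteq> {} \<Longrightarrow> closest S \<in> S \<and> (\<forall>m\<in>S. level m \<le> level (closest S))" for S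
    using closest[of S] fA(2) by blast
  show "w \<in> {1..n} \<and> level v < level w" if w: "w \<in> set_pmf K"
  proof -
    obtain S where S: "S \<subseteq> A" "card S = k" "w = closest S" using w unfolding Keq
      by (auto simp: sP)
    then have "S \<noteq> {}" using k by auto
    with S cl have "w \<in> A" by blast
    then show ?thesis using fA by (auto simp: j_def)
  qed
  have dens: "\<bar>real (card {m \<in> A. j + i < level m}) / real (card A) - 1 / 2 ^ i\<bar> \<le> 4 * \<eta> / 2 ^ i"
    if "i < D" for i
  proof -
    have "{m \<in> A. j + i < level m} = below (Suc j + i)" by (auto simp: A_def below_def)
    moreover have "\<bar>real (card (below (Suc j + i))) / real (card A) - 1 / 2 ^ i\<bar>
      \<le> 4 * \<eta> * (1 / 2 ^ i)"
    proof (rule ratio_close[where x = "real n / 2 ^ Suc j"])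
      show "\<bar>real (card A) - real n / 2 ^ Suc j\<bar> \<le> \<eta> * (real n / 2 ^ Suc j)"
        unfolding A_def using D that by (intro dev) simp
      have "\<bar>real (card (below (Suc j + i))) - real n / 2 ^ (Suc j + i)\<bar>
        \<le> \<eta> * (real n / 2 ^ (Suc j + i))"
        using D that by (intro dev) simp
      then show "\<bar>real (card (below (Suc j + i))) - real n / 2 ^ Suc j * (1 / 2 ^ i)\<bar>
         \<le> \<eta> * (real n / 2 ^ Suc j * (1 / 2 ^ i))" by (simp add: power_add)
    qed (use n0 \<eta> in auto)
    ultimately show ?thesis by simp
  qed
  have "0 \<le> 4 * \<eta>" using \<eta> by simp
  note mom = step_moments[OF fA(1) k kA fA(3) cl this dens, of D, folded Keq, unfolded D(1)]
  have intK: "integrable (measure_pmf K) (h :: nat \<Rightarrow> real)" for h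
    using fK by (rule integrable_measure_pmf_finite)
  let ?\<sigma> = "\<lambda>w. real (min (level w) J) - real j"
  have A0: "0 < real (card A)" using kA k by simp
  have e: "2 * (real k)\<^sup>2 / real (card A) \<le> 8 * (real k)\<^sup>2 / (2 ^ D * 2 ^ r)"
  proof -
    have "2 * (real k)\<^sup>2 / real (card A) \<le> 2 * (real k)\<^sup>2 / (2 ^ (D + r) / 4)"
      using N A0 by (intro divide_left_mono) auto
    then show ?thesis by (simp add: power_add)
  qed
  have "\<bar>?E K (\<lambda>w. mu k - ?\<sigma> w)\<bar> = \<bar>?E K ?\<sigma> - mu k\<bar>" using intK by simp
  also note mom(1)
  \<comment> \<open>The candidate set has at least 2^(D + r) / 4 nodes, so the factor D in the
    sampling error is absorbed by 2^D, leaving 2^-r.\<close>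
  also have "D * (2 * (real k)\<^sup>2 / real (card A)) + 2 * real k * (4 * \<eta>) + 2 * real k / 2 ^ D
    \<le> drift_error k r"
  proof -
    have "D * (2 * (real k)\<^sup>2 / real (card A)) \<le> 2 ^ D * (8 * (real k)\<^sup>2 / (2 ^ D * 2 ^ r))"
      using e less_exp[of D] by (intro mult_mono) (auto simp flip: of_nat_power)
    moreover have "2 * real k / 2 ^ D \<le> 2 * real k / 2 ^ r"
      using D(2) by (intro divide_left_mono power_increasing) auto
    ultimately show ?thesis by (simp add: drift_error_def \<eta>_def)
  qed
  finally show "\<bar>?E K (\<lambda>w. mu k - (real (min (level w) J) - real (level v)))\<bar> \<le> drift_error k r"
    by (simp add: j_def)

  have "?E K (\<lambda>w. (mu k - ?\<sigma> w)\<^sup>2) \<le> ?E K (\<lambda>w. 2 * (mu k)\<^sup>2 + 2 * (?\<sigma> w)\<^sup>2)"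
  proof (rule expectation_mono_finite[OF fK])
    have "(a - b)\<^sup>2 \<le> 2 * a\<^sup>2 + 2 * b\<^sup>2" for a b :: real
      using zero_le_power2[of "a + b"] by (simp add: power2_eq_square algebra_simps)
    then show "(mu k - ?\<sigma> w)\<^sup>2 \<le> 2 * (mu k)\<^sup>2 + 2 * (?\<sigma> w)\<^sup>2" for w .
  qed
  also have "\<dots> = 2 * (mu k)\<^sup>2 + 2 * ?E K (\<lambda>w. (?\<sigma> w)\<^sup>2)" using intK by simp
  also have "?E K (\<lambda>w. (?\<sigma> w)\<^sup>2) \<le> 2 * (real k)\<^sup>2 + 18 * real k"
  proof -
    \<comment> \<open>Likewise \<open>D\<^sup>2\<close> is absorbed by 2^D; \<open>3 \<le> r\<close>
      and \<open>\<eta> \<le> 1 / 2\<close> then fix the constants 2 and 18.\<close>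
    have "(real D)\<^sup>2 * (2 * (real k)\<^sup>2 / real (card A))
      \<le> (2 * 2 ^ D) * (8 * (real k)\<^sup>2 / (2 ^ D * 2 ^ r))"
      using e square_le_two_power by (intro mult_mono) auto
    also have "\<dots> = 16 * (real k)\<^sup>2 / 2 ^ r" by simp
    also have "\<dots> \<le> 16 * (real k)\<^sup>2 / 2 ^ 3"
      using r by (intro divide_left_mono power_increasing) auto
    finally have "(real D)\<^sup>2 * (2 * (real k)\<^sup>2 / real (card A)) \<le> 2 * (real k)\<^sup>2" by simp
    moreover have "6 * real k * (1 + 4 * \<eta>) \<le> 6 * real k * 3" using \<eta>
      by (intro mult_left_mono) auto
    ultimately show ?thesis using mom(2) by simp
  qed
  finally show "?E K (\<lambda>w. (mu k - (real (min (level w) J) - real (level v)))\<^sup>2) \<le> step_var k"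
    by (simp add: j_def step_var_def)
qed

lemma search_time_second_moment:
  assumes g: "good L r" and k: "1 \<le> k" and r: "k + 3 \<le> r" and L: "2 * r \<le> L" "2 ^ L \<le> n" "L \<le> d"
  defines "H \<equiv> end_error k r" and "C \<equiv> step_var k"
  shows "measure_pmf.expectation (law 1) (\<lambda>t. (mu k
    * real t - (real (L - r) - real (min (level 1) (L - r))))\<^sup>2)
    \<le> H\<^sup>2 + L * (C + 2 * C * (drift_error k r * L + H))"
proof -
  let ?K = "\<lambda>v. map_pmf closest (bucket_pmf k (below (Suc (level v))))"
  note ker = step_kernel[OF g k r L(1,2)]
  have mu: "1 \<le> mu k" using mu_ge_one[OF k] .
  have C: "1 \<le> C" using step_var_ge_one[OF k] by (simp add: C_def)
  have H: "0 \<le> H" using mu by (simp add: H_def end_error_def)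
  have k0: "0 \<le> drift_error k r" by (rule drift_error_nonneg)
  have "measure_pmf.expectation (law 1) (\<lambda>t. (mu k
    * real t - (real (L - r) - real (min (level 1) (L - r))))\<^sup>2)
    \<le> H\<^sup>2 + real ((L - 2 * r) - level 1) * (C + 2 * C * (drift_error k r * real (L - 2 * r) + H))"
  proof (rule chain_moments(2)[where V = "{1..n}" and K = ?K and R = law and l = level
      and J = "L - r" and J' = "L - 2 * r" and \<mu> = "mu k" and \<kappa> = "drift_error k r" and C = C
        and H = H])
    fix v assume v: "v \<in> {1..n}" "level v < L - 2 * r"
    show "law v = bind_pmf (?K v) (\<lambda>w. map_pmf Suc (law w))"
      using v L by (intro law_step k ker(1)) auto
    show "finite (set_pmf (?K v))" by (rule ker(2)[OF v])
    show "\<bar>measure_pmf.expectation (?K v) (\<lambda>w. mu k - (real (min (level w) (L - r)) - real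
      (level v)))\<bar>
        \<le> drift_error k r"
      by (rule ker(4)[OF v])
    show "measure_pmf.expectation (?K v) (\<lambda>w. (mu k - (real (min (level w) (L - r)) - real
      (level v)))\<^sup>2) \<le> C"
      unfolding C_def by (rule ker(5)[OF v])
    fix w assume "w \<in> set_pmf (?K v)"
    then show "w \<in> {1..n} \<and> level v < level w" by (rule ker(3)[OF v])
  next
    fix v t assume v: "v \<in> {1..n}" "L - 2 * r \<le> level v" "t \<in> set_pmf (law v)"
    have "level m \<le> L + r" if "m \<in> {1..n}" for m
    proof -
      have "m \<notin> below (L + r)" using g by (simp add: good_def)
      then show ?thesis using that by (simp add: below_def)
    qed
    from set_law_bound[OF v(1,3) this] have t: "t \<le> 3 * r" using v(2) L by simp
    have "mu k * real t \<le> mu k * real (3 * r)" using of_nat_mono[OF t] mu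
      by (intro mult_left_mono) simp_all
    moreover have "0 \<le> mu k * real t" using mu by simp
    moreover have "0 \<le> real (L - r) - real (min (level v) (L - r))" by simp
    moreover have "real (L - r) \<le> real (min (level v) (L - r)) + real r" using v(2) L by simp
    moreover have "0 \<le> mu k * real (3 * r)" using mu by simp
    ultimately show "\<bar>mu k * real t - (real (L - r) - real (min (level v) (L - r)))\<bar> \<le> H"
      unfolding H_def end_error_def by (simp add: mult.commute)
  qed (use n C H k0 finite_set_law in auto)
  also have "\<dots> \<le> H\<^sup>2 + L * (C + 2 * C * (drift_error k r * L + H))"
    using C H k0 by (intro add_left_mono mult_mono add_mono mult_left_mono) auto
  finally show ?thesis .
qed

lemma search_time_deviation:
  assumes g: "good L r" and k: "1 \<le> k" and r: "k + 3 \<le> r"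
    and L: "2 * r \<le> L" "2 ^ L \<le> n" "n < 2 ^ (L + 1)" "L \<le> d"
    and \<epsilon>: "0 < \<epsilon>" "4 * real r + 2 \<le> \<epsilon> * L"
  defines "H \<equiv> end_error k r" and "C \<equiv> step_var k"
  shows "measure_pmf.prob (law 1) {t. \<bar>real t / log 2 (real n) - 1 / mu k\<bar> > \<epsilon>}
    \<le> 4 * (H\<^sup>2 + L * (C + 2 * C * (drift_error k r * L + H))) / (\<epsilon> * L)\<^sup>2"
proof -
  define Y where "Y = (\<lambda>t. mu k * real t - (real (L - r) - real (min (level 1) (L - r))))"
  define l where "l = log 2 (real n)"
  have n0: "0 < real n" using n by simp
  have l: "real L \<le> l" "l \<le> real L + 1"
  proof -
    show "real L \<le> l" unfolding l_def using L(2) n0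
      by (simp add: le_log_iff powr_realpow flip: of_nat_power)
    have "real n < 2 ^ (L + 1)" using L(3) by (metis of_nat_less_iff of_nat_numeral of_nat_power)
    then have "real n \<le> 2 powr (real L + 1)" by (simp add: powr_add powr_realpow)
    then show "l \<le> real L + 1" unfolding l_def using n0 by (simp add: log_le_iff)
  qed
  have L0: "0 < real L" using L r by simp
  have mu: "1 \<le> mu k" using mu_ge_one[OF k] .
  have "{t. \<bar>real t / l - 1 / mu k\<bar> > \<epsilon>} \<subseteq> {t. (\<epsilon> * L / 2)\<^sup>2 \<le> (Y t)\<^sup>2}"
  proof
    fix t assume "t \<in> {t. \<bar>real t / l - 1 / mu k\<bar> > \<epsilon>}"
    then have "\<epsilon> < \<bar>real t / l - 1 / mu k\<bar>" by simp
    also have "real t / l - 1 / mu k = (mu k * real t - l) / (mu k * l)"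
      using mu l L0 by (simp add: field_simps)
    finally have "\<epsilon> * (mu k * l) < \<bar>mu k * real t - l\<bar>" using mu l L0
      by (simp add: abs_divide field_simps)
    moreover have "\<epsilon> * L \<le> \<epsilon> * (mu k * l)"
      using mult_mono[OF mu l(1)] mu \<epsilon>(1) L0 by (intro mult_left_mono) auto
    moreover have "level 1 < r" using g by (simp add: good_def)
    then have "real (min (level 1) (L - r)) \<le> r" "real (L - r) = real L - r" using L by auto
    \<comment> \<open>Replacing log2 n by the distance in \<open>Y\<close> costs at most 1 for
      rounding, r for the truncation and r for the level of node 1; the assumption 4 * r + 2 \<le>
      \<epsilon> * L makes this at most half.\<close>
    ultimately have "\<epsilon> * L / 2 \<le> \<bar>Y t\<bar>" using l \<epsilon>(2) unfolding Y_def by linarith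
    then have "(\<epsilon> * L / 2)\<^sup>2 \<le> \<bar>Y t\<bar>\<^sup>2" using \<epsilon>(1) by (intro power_mono) auto
    then show "t \<in> {t. (\<epsilon> * L / 2)\<^sup>2 \<le> (Y t)\<^sup>2}" by simp
  qed
  then have "measure_pmf.prob (law 1) {t. \<bar>real t / l - 1 / mu k\<bar> > \<epsilon>}
     \<le> measure_pmf.prob (law 1) {t. (\<epsilon> * L / 2)\<^sup>2 \<le> (Y t)\<^sup>2}"
    by (intro measure_pmf.finite_measure_mono) auto
  also have "\<dots> \<le> measure_pmf.expectation (law 1) (\<lambda>t. (Y t)\<^sup>2) / (\<epsilon> * L / 2)\<^sup>2"
    by (rule prob_ge_le_expectation) (use finite_set_law \<epsilon> L0 in auto)
  also have "\<dots> \<le> (H\<^sup>2 + L * (C + 2 * C * (drift_error k r * L + H))) / (\<epsilon> * L / 2)\<^sup>2"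
    using search_time_second_moment[OF g k r L(1,2,4)] unfolding Y_def H_def C_def
    by (intro divide_right_mono) auto
  finally show ?thesis by (simp add: l_def power_divide mult.commute)
qed

text \<open>A node of level beyond L is counted once in each level between L and its own, so the
  total count dominates the excess of the largest level. The sum replaces a maximum because its mean
  is computed by linearity; no \<open>good\<close> IDs are required.\<close>

lemma search_time_le:
  assumes "t \<in> set_pmf (law 1)"
  shows "t \<le> L + (\<Sum>j\<in>{L+1..d}. card (below j))"
proof -
  have "level m \<le> L + (\<Sum>j\<in>{L+1..d}. card (below j))" if m: "m \<in> {1..n}" for m
  proof -
    have "level m - L = (\<Sum>j\<in>{L+1..level m}. 1)" by simp
    also have "\<dots> \<le> (\<Sum>j\<in>{L+1..level m}. card (below j))"
    proof (rule sum_mono)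
      fix j assume "j \<in> {L+1..level m}"
      then have "m \<in> below j" using m by (auto simp: below_def)
      then show "1 \<le> card (below j)" using finite_below by (auto simp: Suc_le_eq card_gt_0_iff)
    qed
    also have "\<dots> \<le> (\<Sum>j\<in>{L+1..d}. card (below j))"
      using lcp_le[of y "X m"] y by (intro sum_mono2) (auto simp: level_def)
    finally show ?thesis by simp
  qed
  from set_law_bound[OF _ assms this] n show ?thesis by simp
qed

end

section \<open>Concentration\<close>

lemma prob_mono_support:
  assumes "\<And>x. x \<in> set_pmf p \<Longrightarrow> x \<in> A \<Longrightarrow> x \<in> B"
  shows "measure_pmf.prob p A \<le> measure_pmf.prob p B"
proof -
  have "measure_pmf.prob p A = measure_pmf.prob p (A \<inter> set_pmf p)"
    by (simp add: measure_Int_set_pmf)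
  also have "\<dots> \<le> measure_pmf.prob p B"
    using assms by (intro measure_pmf.finite_measure_mono) auto
  finally show ?thesis .
qed

definition subtree :: "bool list \<Rightarrow> nat \<Rightarrow> bool list set" where
  "subtree y j = {x \<in> bitstrings (length y). j \<le> lcp y x}"

lemma card_subtree_div: "j \<le> length y \<Longrightarrow> real (card (subtree y j)) / 2 ^ length y = 1 / 2 ^ j"
  by (simp add: subtree_def card_subtree) (simp add: power_diff)

lemma card_subtree_div_le: "real (card (subtree y j)) / 2 ^ length y \<le> 1 / 2 ^ j"
proof (cases "j \<le> length y")
  case False
  then have "subtree y j = {}" using lcp_le[of y] by (auto simp: subtree_def) (meson le_trans)
  then show ?thesis by simp
qed (simp add: card_subtree_div)

lemma sum_two_power_lessThan: "(\<Sum>j\<le>m. 2 ^ j) \<le> (2 * 2 ^ m :: real)"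
  by (induction m) auto

lemma sum_geometric_tail: "L \<le> d \<Longrightarrow> (\<Sum>j\<in>{L+1..d}. 1 / 2 ^ j) = (1 / 2 ^ L - 1 / 2 ^ d :: real)"
  by (induction d rule: dec_induct) auto

context id_space
begin

lemma kademlia_ids:
  assumes "X \<in> set_pmf ids" "length y = d"
  shows "kademlia_ids n d y X"
  using assms n d by unfold_locales (auto simp: set_ids)

lemma subtree_sub: "length y = d \<Longrightarrow> subtree y j \<subseteq> bitstrings d"
  by (auto simp: subtree_def)

lemma card_below:
  assumes "X \<in> set_pmf ids" "length y = d"
  shows "card (kademlia_ids.below n y X j) = visits (subtree y j) X"
proof -
  interpret kademlia_ids k n d y X by (rule kademlia_ids[OF assms])
  have "below j = {i \<in> {1..n}. X i \<in> subtree y j}"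
    using ids_in[OF assms(1)] assms(2) by (auto simp: below_def level_def subtree_def)
  then show ?thesis by (simp add: visits_def)
qed

lemma kademlia_eq:
  fixes y :: "bool list"
  assumes "length y = d"
  shows "kademlia k n d = bind_pmf ids (\<lambda>X. map_pmf (Pair X) (kademlia_ids.buckets k n d X))"
  unfolding kademlia_def ids_def[symmetric]
proof (rule bind_pmf_cong[OF refl])
  fix X assume "X \<in> set_pmf ids"
  interpret kademlia_ids k n d y X by (rule kademlia_ids[OF \<open>X \<in> _\<close> assms])
  show "map_pmf (Pair X) (Pi_pmf ({1..n} \<times> {..<d}) {}
    (\<lambda>(i, j). bucket_pmf k (nodes_at n X (X i) j)))
      = map_pmf (Pair X) buckets"
    by (simp add: buckets_def)
qed

lemma finite_set_kademlia:
  fixes y :: "bool list"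
  assumes "length y = d"
  shows "finite (set_pmf (kademlia k n d))"
proof -
  have "finite (set_pmf (map_pmf (Pair X) (kademlia_ids.buckets k n d X)))"
    if "X \<in> set_pmf ids" for X
    using kademlia_ids.finite_set_buckets[OF kademlia_ids[OF that assms]] by simp
  then show ?thesis unfolding kademlia_eq[OF assms] set_bind_pmf using finite_set_ids by blast
qed

lemma prob_kademlia:
  assumes "length y = d"
  shows "measure_pmf.prob (kademlia k n d) {\<omega>. P (search_time d y 1 \<omega>)}
    = measure_pmf.expectation ids (\<lambda>X. measure_pmf.prob (kademlia_ids.law k n d y X 1) {t. P t})"
proof -
  have "measure_pmf.prob (kademlia k n d) {\<omega>. P (search_time d y 1 \<omega>)}
    = measure_pmf.expectation (kademlia k n d) (indicat_real {\<omega>. P (search_time d y 1 \<omega>)})"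
      by simp
  also have "\<dots> = measure_pmf.expectation ids (\<lambda>X. measure_pmf.expectation
      (map_pmf (Pair X) (kademlia_ids.buckets k n d X)) (indicat_real {\<omega>. P (search_time d y 1
        \<omega>)}))"
    unfolding kademlia_eq[OF assms]
    by (rule expectation_bind_finite[OF finite_set_ids])
       (use kademlia_ids.finite_set_buckets[OF kademlia_ids[OF _ assms]] in auto)
  also have "\<dots> = measure_pmf.expectation ids (\<lambda>X. measure_pmf.prob (kademlia_ids.law k n d y X
    1) {t. P t})"
  proof (intro integral_cong_AE)
    show "AE X in ids. measure_pmf.expectation (map_pmf (Pair X) (kademlia_ids.buckets k n d X))
        (indicat_real {\<omega>. P (search_time d y 1 \<omega>)})
      = measure_pmf.prob (kademlia_ids.law k n d y X 1) {t. P t}"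
      unfolding AE_measure_pmf_iff
    proof
      fix X assume X: "X \<in> set_pmf ids"
      interpret kademlia_ids k n d y X by (rule kademlia_ids[OF X assms])
      show "measure_pmf.expectation (map_pmf (Pair X) buckets) (indicat_real {\<omega>. P (search_time
        d y 1 \<omega>)})
        = measure_pmf.prob (law 1) {t. P t}"
        by (simp add: law_def vimage_def del: integral_map_pmf)
    qed
  qed auto
  finally show ?thesis .
qed

text \<open>Union bound. Chebyshev gives at most r^2 2^j / n at level j, a geometric sum dominated
  by the last level \<open>L - r\<close>; Markov's inequality gives 2 / 2^r for a node at
  \<open>L + r\<close>, and the start node lies at level r or deeper with probability at most 1 /
  2^r.\<close>

lemma prob_not_good:
  assumes y: "length y = d" and r: "1 \<le> r" "r \<le> L" and L: "2 ^ L \<le> n" "n < 2 ^ (L + 1)" "L \<le> d"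
  shows "measure_pmf.prob ids {X. \<not> kademlia_ids.good n y X L r} \<le> (2 * (real r)\<^sup>2 + 3) / 2 ^ r"
proof -
  let ?P = "measure_pmf.prob ids"
  define J where "J = L - r"
  define B1 where "B1 = (\<lambda>j. {X. 1 / real r * (n * (card (subtree y j) / 2 ^ d))
      \<le> \<bar>real (visits (subtree y j) X) - n * (card (subtree y j) / 2 ^ d)\<bar>})"
  define B2 where "B2 = {X. 1 \<le> real (visits (subtree y (L + r)) X)}"
  define B3 where "B3 = {X :: nat \<Rightarrow> bool list. X 1 \<in> subtree y r}"
  note sub = subtree_sub[OF y]
  have n0: "0 < real n" using n by simp
  have "real n < 2 ^ (L + 1)" using L(2) by (metis of_nat_less_iff of_nat_numeral of_nat_power)
  then have Lr: "2 ^ L \<le> real n" "real n \<le> 2 * 2 ^ L"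
    using L(1) by (simp_all flip: of_nat_power)
  have eq: "card (subtree y j) / 2 ^ d = 1 / (2 ^ j :: real)" if "j \<le> J" for j
    using card_subtree_div[of j y] that L y by (simp add: J_def)
  have "?P {X. \<not> kademlia_ids.good n y X L r} \<le> ?P ((\<Union>j\<in>{..J}. B1 j) \<union> B2 \<union> B3)"
  proof (rule prob_mono_support)
    fix X assume XI: "X \<in> set_pmf ids" and bad: "X \<in> {X. \<not> kademlia_ids.good n y X L r}"
    interpret kademlia_ids k n d y X by (rule kademlia_ids[OF XI y])
    note cb = card_below[OF XI y]
    show "X \<in> (\<Union>j\<in>{..J}. B1 j) \<union> B2 \<union> B3"
    proof (rule ccontr)
      assume "\<not> ?thesis"
      then have no: "\<And>j. j \<le> J \<Longrightarrow> X \<notin> B1 j" "X \<notin> B2" "X \<notin> B3" by auto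
      have "\<bar>real (card (below j)) - real n / 2 ^ j\<bar> \<le> 1 / real r * (real n / 2 ^ j)"
        if "j \<le> J" for j
        using no(1)[OF that] unfolding B1_def mem_Collect_eq eq[OF that] cb by simp
      moreover have "card (below (L + r)) = 0"
        using no(2) cb[of "L + r"] by (simp add: B2_def)
      then have "below (L + r) = {}" using finite_below by simp
      moreover have "level 1 < r"
        using no(3) ids_in[OF XI] n y by (simp add: B3_def subtree_def level_def)
      ultimately show False using bad by (simp add: good_def J_def)
    qed
  qed
  also have "\<dots> \<le> (\<Sum>j\<le>J. ?P (B1 j)) + ?P B2 + ?P B3"
    using measure_Un_le[of "(\<Union>j\<in>{..J}. B1 j) \<union> B2" ids B3]
      measure_Un_le[of "\<Union>j\<in>{..J}. B1 j" ids B2]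
      measure_UNION_le[of "{..J}" B1 ids] by simp
  also have "(\<Sum>j\<le>J. ?P (B1 j)) \<le> (\<Sum>j\<le>J. (real r)\<^sup>2 / 2 ^ L * 2 ^ j)"
  proof (rule sum_mono)
    fix j assume "j \<in> {..J}"
    then have j: "j \<le> J" by simp
    have ne: "subtree y j \<noteq> {}" using eq[OF j] by (auto simp: divide_eq_0_iff)
    have "?P (B1 j) \<le> 1 / ((1 / real r)\<^sup>2 * (n * (card (subtree y j) / 2 ^ d)))"
      unfolding B1_def using r by (intro prob_visits_deviation sub ne) simp
    also have "\<dots> = (real r)\<^sup>2 * 2 ^ j / n"
      unfolding eq[OF j] using r by (simp add: power_divide)
    also have "\<dots> \<le> (real r)\<^sup>2 * 2 ^ j / 2 ^ L"
      using Lr n0 by (intro divide_left_mono) auto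
    finally show "?P (B1 j) \<le> (real r)\<^sup>2 / 2 ^ L * 2 ^ j" by simp
  qed
  also have "\<dots> \<le> (real r)\<^sup>2 / 2 ^ L * (2 * 2 ^ J)"
    unfolding sum_distrib_left[symmetric] by (intro mult_left_mono sum_two_power_lessThan) auto
  also have "\<dots> = 2 * (real r)\<^sup>2 / 2 ^ r" using r by (simp add: J_def power_diff)
  also have "?P B2 \<le> 2 / 2 ^ r"
  proof -
    have "?P B2 \<le> measure_pmf.expectation ids (\<lambda>X. real (visits (subtree y (L + r)) X)) / 1"
      unfolding B2_def by (rule prob_ge_le_expectation[OF finite_set_ids]) auto
    also have "\<dots> = n * (card (subtree y (L + r)) / 2 ^ d)" using expectation_visits[OF sub]
      by simp
    also have "\<dots> \<le> (2 * 2 ^ L) * (1 / 2 ^ (L + r))"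
      using Lr n0 card_subtree_div_le[of y "L + r"] y by (intro mult_mono) auto
    also have "\<dots> = 2 / 2 ^ r" by (simp add: power_add)
    finally show ?thesis .
  qed
  also have "?P B3 \<le> 1 / 2 ^ r"
    unfolding B3_def using prob_id[OF _ sub, of 1] n card_subtree_div_le[of y r] y by simp
  also have "2 * (real r)\<^sup>2 / 2 ^ r + 2 / 2 ^ r + 1 / 2 ^ r = (2 * (real r)\<^sup>2 + 3) / 2 ^ r"
    by (simp add: add_divide_distrib)
  finally show ?thesis by simp
qed

lemma prob_search_time_deviation:
  assumes y: "length y = d" and k: "1 \<le> k" and r: "k + 3 \<le> r"
    and L: "2 * r \<le> L" "2 ^ L \<le> n" "n < 2 ^ (L + 1)" "L \<le> d"
    and \<epsilon>: "0 < \<epsilon>" "4 * real r + 2 \<le> \<epsilon> * L"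
  defines "H \<equiv> end_error k r" and "C \<equiv> step_var k"
  shows "measure_pmf.prob (kademlia k n d) {\<omega>. \<bar>real (search_time d y 1 \<omega>) / log 2 (real n) - 1
    / mu k\<bar> > \<epsilon>}
    \<le> (2 * (real r)\<^sup>2 + 3) / 2 ^ r + 4 * (H\<^sup>2 + L * (C + 2 * C * (drift_error k r * L
      + H))) / (\<epsilon> * L)\<^sup>2"
    (is "?lhs \<le> _ + ?\<beta>")
proof -
  let ?q = "\<lambda>X. measure_pmf.prob (kademlia_ids.law k n d y X 1) {t. \<bar>real t / log 2 (real n) - 1
    / mu k\<bar> > \<epsilon>}"
  let ?I = "indicat_real {X. \<not> kademlia_ids.good n y X L r}"
  have C: "1 \<le> C" using step_var_ge_one[OF k] by (simp add: C_def)
  have H: "0 \<le> H" using mu_ge_one[OF k] by (simp add: H_def end_error_def)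
  have \<beta>: "0 \<le> ?\<beta>" using C H drift_error_nonneg[of k r] by simp
  have "?lhs = measure_pmf.expectation ids ?q" by (rule prob_kademlia[OF y])
  also have "\<dots> \<le> measure_pmf.expectation ids (\<lambda>X. ?I X + ?\<beta>)"
  proof (rule expectation_mono_finite[OF finite_set_ids])
    fix X assume X: "X \<in> set_pmf ids"
    interpret kademlia_ids k n d y X by (rule kademlia_ids[OF X y])
    show "?q X \<le> ?I X + ?\<beta>"
    proof (cases "good L r")
      case True
      from search_time_deviation[OF this k r L \<epsilon>] True show ?thesis by (simp add: H_def C_def)
    next
      case False
      then have "?I X = 1" by simp
      moreover have "?q X \<le> 1" by (rule measure_pmf.prob_le_1)
      ultimately show ?thesis using \<beta> by linarith
    qed
  qed
  also have "\<dots> = measure_pmf.prob ids {X. \<not> kademlia_ids.good n y X L r} + ?\<beta>"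
    using integrable_ids by simp
  also have "measure_pmf.prob ids {X. \<not> kademlia_ids.good n y X L r}
    \<le> (2 * (real r)\<^sup>2 + 3) / 2 ^ r"
    by (rule prob_not_good) (use y r L in auto)
  finally show ?thesis by simp
qed

text \<open>The deviation is at most \<epsilon> off the exceptional event and at most 2 + Z / log2 n
  on it, where Z counts nodes in levels beyond L. As Z has bounded mean, convergence in probability
  carries over to the mean.\<close>

lemma expectation_search_time_deviation:
  assumes y: "length y = d" and k: "1 \<le> k" and n2: "2 \<le> n" and \<epsilon>: "0 < \<epsilon>"
  defines "dev \<equiv> \<lambda>\<omega>. \<bar>real (search_time d y 1 \<omega>) / log 2 (real n) - 1 / mu k\<bar>"
  shows "\<bar>measure_pmf.expectation (kademlia k n d)
    (\<lambda>\<omega>. real (search_time d y 1 \<omega>)) / log 2 (real n) - 1 / mu k\<bar>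
    \<le> \<epsilon> + 2 * measure_pmf.prob (kademlia k n d) {\<omega>. dev \<omega> > \<epsilon>} + 2 / log 2 (real n)"
proof -
  let ?K = "kademlia k n d" and ?E = "measure_pmf.expectation"
  define l where "l = log 2 (real n)"
  obtain L where L: "2 ^ L \<le> n" "n < 2 ^ (L + 1)" using ex_power_ivl1[of 2 n] n by auto
  have n0: "0 < real n" using n by simp
  have l: "0 < l" using n2 by (simp add: l_def)
  have Ll: "real L \<le> l" unfolding l_def using L(1) n0
    by (simp add: le_log_iff powr_realpow flip: of_nat_power)
  then have "real L \<le> real d" using d by (simp add: l_def)
  then have Ld: "L \<le> d" by simp
  have mu: "0 \<le> 1 / mu k" "1 / mu k \<le> 1" using mu_ge_one[OF k] by auto
  define Z where "Z = (\<lambda>X. \<Sum>j\<in>{L+1..d}. real (visits (subtree y j) X))"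
  have fK: "finite (set_pmf ?K)" by (rule finite_set_kademlia[OF y])
  have int: "integrable (measure_pmf ?K) (h :: _ \<Rightarrow> real)" for h using fK
    by (rule integrable_measure_pmf_finite)
  \<comment> \<open>The expected level sizes n / 2^j beyond L sum to at most n / 2^L, which is below
    2 by the choice of L.\<close>
  have EZ: "?E ?K (\<lambda>\<omega>. Z (fst \<omega>)) \<le> 2"
  proof -
    have "?E ?K (\<lambda>\<omega>. Z (fst \<omega>)) = ?E ids Z"
    proof -
      have "map_pmf fst ?K = ids"
        unfolding kademlia_eq[OF y]
          by (simp add: map_bind_pmf pmf.map_comp o_def bind_return_pmf')
      then show ?thesis by (metis integral_map_pmf)
    qed
    also have "\<dots> = (\<Sum>j\<in>{L+1..d}. n * (card (subtree y j) / 2 ^ d))"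
      unfolding Z_def by (subst Bochner_Integration.integral_sum)
        (simp_all add: integrable_ids expectation_visits[OF subtree_sub[OF y]])
    also have "\<dots> \<le> (\<Sum>j\<in>{L+1..d}. n * (1 / 2 ^ j))"
      using card_subtree_div_le[of y] y by (intro sum_mono mult_left_mono) auto
    also have "\<dots> = n * (1 / 2 ^ L - 1 / 2 ^ d)"
      unfolding sum_distrib_left[symmetric] sum_geometric_tail[OF Ld] ..
    also have "\<dots> \<le> n * (1 / 2 ^ L)" by (intro mult_left_mono) auto
    also have "\<dots> \<le> 2"
    proof -
      have "real n < 2 ^ (L + 1)" using L(2)
        by (metis of_nat_less_iff of_nat_numeral of_nat_power)
      then show ?thesis by (simp add: field_simps)
    qed
    finally show ?thesis .
  qed
  have "\<bar>?E ?K (\<lambda>\<omega>. real (search_time d y 1 \<omega>)) / l - 1 / mu k\<bar>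
    = \<bar>?E ?K (\<lambda>\<omega>. real (search_time d y 1 \<omega>) / l - 1 / mu k)\<bar>"
    using int by simp
  also have "\<dots> \<le> ?E ?K dev" unfolding dev_def l_def by (rule integral_abs_bound)
  also have "\<dots> \<le> ?E ?K (\<lambda>\<omega>. \<epsilon> + 2 * indicat_real {\<omega>. dev \<omega> > \<epsilon>} \<omega> + Z (fst \<omega>) / l)"
  proof (rule expectation_mono_finite[OF fK])
    fix \<omega> assume \<omega>: "\<omega> \<in> set_pmf ?K"
    then obtain X B where XB: "\<omega> = (X, B)" "X \<in> set_pmf ids" "B \<in> set_pmf (kademlia_ids.buckets
      k n d X)"
      unfolding kademlia_eq[OF y] by auto
    interpret kademlia_ids k n d y X by (rule kademlia_ids[OF XB(2) y])
    have "search_time d y 1 \<omega> \<in> set_pmf (law 1)" using XB by (auto simp: law_def)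
    from search_time_le[OF this, of L]
    have "search_time d y 1 \<omega> \<le> L + (\<Sum>j\<in>{L+1..d}. visits (subtree y j) X)"
      using card_below[OF XB(2) y] by simp
    then have "real (search_time d y 1 \<omega>) \<le> real (L + (\<Sum>j\<in>{L+1..d}. visits (subtree y j) X))"
      by (rule of_nat_mono)
    then have "real (search_time d y 1 \<omega>) \<le> l + Z X" using Ll by (simp add: Z_def)
    then have T: "real (search_time d y 1 \<omega>) / l \<le> 1 + Z X / l" using l by (simp add: field_simps)
    have Z0: "0 \<le> Z X / l" "0 \<le> real (search_time d y 1 \<omega>) / l" using l
      by (auto simp: Z_def sum_nonneg)
    show "dev \<omega> \<le> \<epsilon> + 2 * indicat_real {\<omega>. dev \<omega> > \<epsilon>} \<omega> + Z (fst \<omega>) / l"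
    proof (cases "dev \<omega> > \<epsilon>")
      case True
      have "dev \<omega> \<le> 2 + Z X / l" using T Z0 mu unfolding dev_def l_def[symmetric] by linarith
      then show ?thesis using True \<epsilon> XB(1) by simp
    next
      case False
      then show ?thesis using Z0 XB(1) by simp
    qed
  qed
  also have "\<dots> = \<epsilon> + 2 * measure_pmf.prob ?K {\<omega>. dev \<omega> > \<epsilon>} + ?E ?K (\<lambda>\<omega>. Z (fst \<omega>)) / l"
    using int by simp
  also have "\<dots> \<le> \<epsilon> + 2 * measure_pmf.prob ?K {\<omega>. dev \<omega> > \<epsilon>} + 2 / l"
    using EZ l by (intro add_left_mono divide_right_mono) auto
  finally show ?thesis by (simp add: l_def)
qed

end

text \<open>The threshold N depends on neither d nor y. First r brings the failure probability and
  the drift contribution below e / 3 each; then a large L brings the rest below e / 3.\<close>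

lemma search_time_concentration:
  assumes k: "1 \<le> k" and \<epsilon>: "0 < \<epsilon>" and e: "0 < e"
  shows "\<exists>N. \<forall>n\<ge>N. \<forall>d y. real d \<ge> log 2 (real n) \<longrightarrow> length y = d \<longrightarrow>
    measure_pmf.prob (kademlia k n d) {\<omega>. \<bar>real (search_time d y 1 \<omega>) / log 2 (real n) - 1 / mu
      k\<bar> > \<epsilon>} < e"
proof -
  define C where "C = step_var k"
  have "(\<lambda>r. (2 * (real r)\<^sup>2 + 3) / 2 ^ r) \<longlonglongrightarrow> 0" by real_asymp
  then have 1: "\<forall>\<^sub>F r in sequentially. (2 * (real r)\<^sup>2 + 3) / 2 ^ r < e / 3"
    using e by (intro order_tendstoD(2)) auto
  \<comment> \<open>This is the quadratic part of the second-moment bound after division by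
    (\<epsilon> L)^2. It is independent of L, so only r can make it small.\<close>
  have "(\<lambda>r. 8 * C * drift_error k r / \<epsilon>\<^sup>2) \<longlonglongrightarrow> 8 * C * (8 * (real k)\<^sup>2 * 0 + 8 * real k * 0
    + 2 * real k * 0) / \<epsilon>\<^sup>2"
    unfolding drift_error_def divide_inverse[of "_ * _"] using \<epsilon>
    by (intro tendsto_intros) real_asymp+
  then have "(\<lambda>r. 8 * C * drift_error k r / \<epsilon>\<^sup>2) \<longlonglongrightarrow> 0" by simp
  then have 2: "\<forall>\<^sub>F r in sequentially. 8 * C * drift_error k r / \<epsilon>\<^sup>2 < e / 3"
    using e by (intro order_tendstoD(2)) auto
  obtain r where r: "(2 * (real r)\<^sup>2 + 3) / 2 ^ r < e / 3" "8 * C * drift_error k r / \<epsilon>\<^sup>2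
    < e / 3" "k + 3 \<le> r"
    using eventually_conj[OF 1 eventually_conj[OF 2 eventually_ge_at_top[of "k + 3"]]]
    by (auto dest: eventually_happens)
  define H where "H = end_error k r"
  \<comment> \<open>With r fixed, a and b are the coefficients of 1 / L^2 and 1 / L in the remaining
    error.\<close>
  define a where "a = 4 * H\<^sup>2 / \<epsilon>\<^sup>2"
  define b where "b = 4 * (C + 2 * C * H) / \<epsilon>\<^sup>2"
  have "(\<lambda>L. a * (1 / (real L)\<^sup>2) + b * (1 / real L)) \<longlonglongrightarrow> a * 0 + b * 0"
    by (intro tendsto_intros) real_asymp+
  then have 3: "\<forall>\<^sub>F L in sequentially. a * (1 / (real L)\<^sup>2) + b * (1 / real L) < e / 3"
    using e by (intro order_tendstoD(2)) auto
  have 4: "\<forall>\<^sub>F L in sequentially. 4 * real r + 2 \<le> \<epsilon> * real L"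
  proof -
    have "\<forall>\<^sub>F L in sequentially. (4 * real r + 2) / \<epsilon> \<le> real L"
      using filterlim_real_sequentially unfolding filterlim_at_top by blast
    then show ?thesis by eventually_elim (use \<epsilon> in \<open>simp add: field_simps\<close>)
  qed
  obtain L0 where L0: "\<And>L. L \<ge> L0 \<Longrightarrow> a * (1 / (real L)\<^sup>2) + b * (1 / real L) < e / 3
      \<and> 4 * real r + 2 \<le> \<epsilon> * real L \<and> 2 * r \<le> L"
    using eventually_conj[OF 3 eventually_conj[OF 4 eventually_ge_at_top[of "2 * r"]]]
    unfolding eventually_sequentially by blast
  show ?thesis
  proof (intro exI[of _ "2 ^ L0"] allI impI)
    fix n d :: nat and y :: "bool list"
    assume nL: "2 ^ L0 \<le> n" and d: "log 2 (real n) \<le> real d" and y: "length y = d"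
    have n1: "1 \<le> n" using nL by (meson le_trans one_le_numeral one_le_power)
    interpret id_space n d by unfold_locales (use n1 d in auto)
    obtain L where L: "2 ^ L \<le> n" "n < 2 ^ (L + 1)" using ex_power_ivl1[of 2 n] n1 by auto
    have "(2::nat) ^ L0 < 2 ^ (L + 1)" using nL L(2) by (rule le_less_trans)
    then have "L0 < L + 1" by (rule power_less_imp_less_exp[rotated]) simp
    then have "L0 \<le> L" by simp
    note LL = L0[OF this]
    have "real L \<le> log 2 (real n)" using L(1) n1
      by (simp add: le_log_iff powr_realpow flip: of_nat_power)
    then have "real L \<le> real d" using d by linarith
    then have Ld: "L \<le> d" by simp
    have Lpos: "0 < real L" using LL r(3) by simp
    have "measure_pmf.prob (kademlia k n d) {\<omega>. \<bar>real (search_time d y 1 \<omega>) / log 2 (real n) - 1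
      / mu k\<bar> > \<epsilon>}
      \<le> (2 * (real r)\<^sup>2 + 3) / 2 ^ r + 4 * (H\<^sup>2 + L * (C + 2 * C * (drift_error k r * L
        + H))) / (\<epsilon> * L)\<^sup>2"
      unfolding H_def C_def using LL by (intro prob_search_time_deviation y k r(3) L Ld \<epsilon>) auto
    also have "4 * (H\<^sup>2 + L * (C + 2 * C * (drift_error k r * L + H))) / (\<epsilon> * L)\<^sup>2
      = (a * (1 / (real L)\<^sup>2) + b * (1 / real L)) + 8 * C * drift_error k r / \<epsilon>\<^sup>2"
      unfolding a_def b_def using Lpos \<epsilon> by (simp add: field_simps power2_eq_square)
    also have "\<dots> < e / 3 + e / 3" using LL r(2) by (intro add_strict_mono) auto
    also note r(1)
    finally show "measure_pmf.prob (kademlia k n d)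
      {\<omega>. \<bar>real (search_time d y 1 \<omega>) / log 2 (real n) - 1 / mu k\<bar> > \<epsilon>} < e" by simp
  qed
qed

lemma mu_one: "mu 1 = 2"
proof -
  have "mu 1 = (\<Sum>j. (1 / 2) ^ j)" by (simp add: mu_def power_one_over)
  also have "\<dots> = 2" by (subst suminf_geometric) auto
  finally show ?thesis .
qed

theorem theorem1:
  fixes k :: nat and d :: "nat \<Rightarrow> nat" and y :: "nat \<Rightarrow> bool list"
  assumes k: "k \<ge> 1"
    and d: "\<And>n. n \<ge> 1 \<Longrightarrow> real (d n) \<ge> log 2 (real n)"
    and y: "\<And>n. n \<ge> 1 \<Longrightarrow> y n \<in> bitstrings (d n)"
  shows "(\<forall>\<epsilon>>0. (\<lambda>n. measure_pmf.prob (kademlia k n (d n))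
             {\<omega>. \<bar>real (search_time (d n) (y n) 1 \<omega>) / log 2 (real n) - 1 / mu k\<bar> > \<epsilon>})
           \<longlonglongrightarrow> 0)
       \<and> (\<lambda>n. measure_pmf.expectation (kademlia k n (d n))
             (\<lambda>\<omega>. real (search_time (d n) (y n) 1 \<omega>)) / log 2 (real n))
           \<longlonglongrightarrow> 1 / mu k
       \<and> mu 1 = 2"
proof (intro conjI allI impI)
  let ?P = "\<lambda>\<epsilon> n. measure_pmf.prob (kademlia k n (d n))
             {\<omega>. \<bar>real (search_time (d n) (y n) 1 \<omega>) / log 2 (real n) - 1 / mu k\<bar> > \<epsilon>}"
  let ?F = "\<lambda>n. measure_pmf.expectation (kademlia k n (d n))
             (\<lambda>\<omega>. real (search_time (d n) (y n) 1 \<omega>)) / log 2 (real n)"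
  have ev: "\<forall>\<^sub>F n in sequentially. ?P \<epsilon> n < e" if pos: "0 < \<epsilon>" "0 < e" for \<epsilon> e
  proof -
    obtain N where N: "\<And>n d y. n \<ge> N \<Longrightarrow> real d \<ge> log 2 (real n) \<Longrightarrow> length y = d \<Longrightarrow>
      measure_pmf.prob (kademlia k n d) {\<omega>. \<bar>real (search_time d y 1 \<omega>) / log 2 (real n) - 1 / mu k\<bar> > \<epsilon>} < e"
      using search_time_concentration[OF k pos] by blast
    show ?thesis
      \<comment> \<open>The hypotheses on d and y are available only from n = 1 on.\<close>
      using eventually_ge_at_top[of "max N 1"]
      by eventually_elim (use N d y in \<open>auto simp: bitstrings_def\<close>)
  qed
  show "?P \<epsilon> \<longlonglongrightarrow> 0" if "0 < \<epsilon>" for \<epsilon>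
  proof (rule order_tendstoI)
    show "\<forall>\<^sub>F n in sequentially. a < ?P \<epsilon> n" if "a < 0" for a
      using that by (intro always_eventually allI) (meson less_le_trans measure_nonneg)
  qed (rule ev[OF that])
  show "?F \<longlonglongrightarrow> 1 / mu k"
  proof (rule tendstoI)
    fix e :: real assume e: "0 < e"
    have "(\<lambda>n. 2 / log 2 (real n)) \<longlonglongrightarrow> 0" by real_asymp
    then have "\<forall>\<^sub>F n in sequentially. 2 / log 2 (real n) < e / 4"
      using e by (intro order_tendstoD(2)) auto
    \<comment> \<open>The probability enters the bound for the mean twice, so the three errors are e
      / 4, less than 2 * (e / 4) and less than e / 4, in total below e.\<close>
    moreover have "\<forall>\<^sub>F n in sequentially. ?P (e / 4) n < e / 4" using e by (intro ev) auto
    ultimately show "\<forall>\<^sub>F n in sequentially. dist (?F n) (1 / mu k) < e"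
      using eventually_ge_at_top[of 2]
    proof eventually_elim
      case (elim n)
      interpret id_space n "d n" by unfold_locales (use elim d in auto)
      have "length (y n) = d n" using y[of n] elim by (simp add: bitstrings_def)
      from expectation_search_time_deviation[OF this k elim(3), of "e / 4"] e elim
      show ?case by (simp add: dist_real_def)
    qed
  qed
  show "mu 1 = 2" by (rule mu_one)
qed

end
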